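(* Every unsatisfiable standard datum is QDC-refutable, i.e. there is a QDC-deduction of $\bot$ from it.
   Context: The language is first-order predicate logic with logical constants $\neg,\wedge,\vee,\forall,\exists$, individual variables, and for each $n\ge 0$ denumerably many $n$-ary predicate variables and $n$-ary functional variables; no identity. A datum is an expression $(E\underline{f})(\underline{x}):M$ where $\underline{f}$ is a finite set of functional variables (existential prefix), $\underline{x}$ a finite set of individual variables (universal prefix), and $M$ (the matrix) is a finite set of finite sets of formulas (components). Data are identified if they differ only by renaming of bound variables (prefix variables, and quantified variables inside formulas): precisely, data are equivalence classes under the transitive closure of the relation "one is obtained from the other by some capture-free renaming of bound variables" (so e.g. $\{\{\forall xPx\}\}$ and $\{\{\forall xPx,\forall yPy\}\}$ are the same datum). Semantics: $(E\underline{f})(\underline{x}):M$ is read as "there exist functions $\underline{f}$ such that for all individuals $\underline{x}$, all formulas of some component of $M$ are true"; it is unsatisfiable if no interpretation (non-empty domain, assignment to all free individual, predicate and functional variables) verifies it. $\bot$ is the prefix-free datum with matrix $\{\ \}$. A datum is standard if: (1) all functional variables in the matrix appear in the prefix; (2) functional variables in the matrix are applied only to individual variables; (3) there is a total ordering of the universal prefix such that, in every functional term in the matrix, the arguments, in order, form an initial segment (without repetitions) of the ordering. Notation: $\Gamma,A$ is $\Gamma\cup\{A\}$; $\Gamma,\Delta$ is $\Gamma\cup\Delta$; $\Gamma/\rho$ is $\{\Gamma\}\cup\rho$ and $\Gamma/\Delta/\rho$ is $\{\Gamma,\Delta\}\cup\rho$, with $\rho$ any finite set of finite sets of formulas. All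 substitutions are capture-free; $g\underline{x}$ is $g$ applied to the universal variables $\underline{x}$ listed in some order. Rules of QDC. G-rules (both directions, left-to-right being analytic, right-to-left synthetic). With an unchanged prefix $(E\underline{f})(\underline{x})$: $A\wedge B,\Gamma/\rho$ and $A,B,\Gamma/\rho$; $A\vee B,\Gamma/\rho$ and $A,\Gamma/B,\Gamma/\rho$; $\neg\neg A,\Gamma/\rho$ and $A,\Gamma/\rho$; $\neg(A\vee B),\Gamma/\rho$ and $\neg A,\neg B,\Gamma/\rho$; $\neg(A\wedge B),\Gamma/\rho$ and $\neg A,\Gamma/\neg B,\Gamma/\rho$. Quantifiers: $(E\underline{f})(\underline{x}):\forall yA,\Gamma/\rho$ and $(E\underline{f})(\underline{x},y):A,\Gamma/\rho$, provided $y$ is not free in $\Gamma,\rho$; $(E\underline{f})(\underline{x}):\neg\exists yA,\Gamma/\rho$ and $(E\underline{f})(\underline{x},y):\neg A,\Gamma/\rho$, same proviso; $(E\underline{f})(\underline{x}):\exists yA(y),\Gamma/\rho$ and $(E\underline{f},g)(\underline{x}):A(g\underline{x}),\Gamma/\rho$, provided $g$ does not occur in $A(y),\Gamma,\rho$; $(E\underline{f})(\underline{x}):\neg\forall yA(y),\Gamma/\rho$ and $(E\underline{f},g)(\underline{x}):\neg A(g\underline{x}),\Gamma/\rho$, same proviso. N-rules (prefix unchanged): NC: from $\Gamma,A,\neg A/\rho$ infer $\rho$. EM: from $\Gamma/\rho$ infer $\Gamma,A/\Gamma,\neg A/\rho$. S-rules: Del: from $\Gamma,\Delta/\rho$ infer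 $\Gamma/\rho$ (prefix unchanged). Exp: from $\rho$ infer $\Gamma/\rho$ (prefix unchanged). Inst: from $(E\underline{f})(\underline{x},y):\alpha(y)$ infer $(E\underline{f})(\underline{x}):\alpha(t)$, $t$ any term. Gen: from $(E\underline{f})(\underline{x}):\alpha(t)$ infer $(E\underline{f},g)(\underline{x}):\alpha(g\underline{x})$, $t$ any term, $g$ not in $\underline{f}$ and not occurring in the schema $\alpha(\cdot)$. EVE: from $(E\underline{f},g)(\underline{x}):\alpha$ infer $(E\underline{f})(\underline{x}):\alpha$, provided $g$ does not occur in $\alpha$. IVU: from $(E\underline{f})(\underline{x}):\alpha$ infer $(E\underline{f})(\underline{x},\underline{y}):\alpha$, provided $\underline{y}$ are not free in $\alpha$. A QDC-deduction of $\beta$ from $\alpha$ is a finite sequence of data starting with $\alpha$ and ending with $\beta$, each datum after the first being inferable from the immediately preceding one by one of these rules. *)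

theory Defs
  imports "HOL-Library.FSet"
begin

section \<open>Syntax\<close>

type_synonym var = nat

text \<open>
  The pair (i, n) is the i-th functional variable of arity n. A functional term
  \<open>Fn i ts\<close> is headed by the functional variable (i, length ts), so that every term is
  well formed; in the same way \<open>Pred i ts\<close> is headed by the i-th predicate
  variable of arity length ts.
\<close>

type_synonym fvar = "nat \<times> nat"

datatype tm = Var var | Fn nat "tm list"

datatype fm =
    Pred nat "tm list"
  | Neg fm
  | Conj fm fm
  | Disj fm fm
  | Forall var fm
  | Exists var fm

text \<open>
  \<open>Dat F X M\<close> is the expression with existential prefix F, universal prefix X and
  matrix M. Data are equivalence classes of such expressions, see the type \<open>datum\<close> below.
\<close>

type_synonym matrix = "fm fset fset"

datatype expr = Dat "fvar fset" "var fset" matrix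


subsection \<open>Free variables and functional variables\<close>

fun fv_tm :: "tm \<Rightarrow> var set" where
  "fv_tm (Var x) = {x}"
| "fv_tm (Fn i ts) = (\<Union>t\<in>set ts. fv_tm t)"

primrec fv_fm :: "fm \<Rightarrow> var set" where
  "fv_fm (Pred p ts) = (\<Union>t\<in>set ts. fv_tm t)"
| "fv_fm (Neg A) = fv_fm A"
| "fv_fm (Conj A B) = fv_fm A \<union> fv_fm B"
| "fv_fm (Disj A B) = fv_fm A \<union> fv_fm B"
| "fv_fm (Forall x A) = fv_fm A - {x}"
| "fv_fm (Exists x A) = fv_fm A - {x}"

definition fv_set :: "fm fset \<Rightarrow> var set" where
  "fv_set G = (\<Union>A\<in>fset G. fv_fm A)"

definition fv_mat :: "matrix \<Rightarrow> var set" where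
  "fv_mat M = (\<Union>G\<in>fset M. fv_set G)"

fun funs_tm :: "tm \<Rightarrow> fvar set" where
  "funs_tm (Var x) = {}"
| "funs_tm (Fn i ts) = insert (i, length ts) (\<Union>t\<in>set ts. funs_tm t)"

primrec funs_fm :: "fm \<Rightarrow> fvar set" where
  "funs_fm (Pred p ts) = (\<Union>t\<in>set ts. funs_tm t)"
| "funs_fm (Neg A) = funs_fm A"
| "funs_fm (Conj A B) = funs_fm A \<union> funs_fm B"
| "funs_fm (Disj A B) = funs_fm A \<union> funs_fm B"
| "funs_fm (Forall x A) = funs_fm A"
| "funs_fm (Exists x A) = funs_fm A"

definition funs_mat :: "matrix \<Rightarrow> fvar set" where
  "funs_mat M = (\<Union>G\<in>fset M. \<Union>A\<in>fset G. funs_fm A)"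


subsection \<open>Substitution\<close>

text \<open>
  \<open>subst_fm x t A\<close> replaces the free occurrences of x in A by t without renaming;
  \<open>free_for t x A\<close> says that no variable of t is captured by this. Every use of
  substitution below is guarded by \<open>free_for\<close>; as data are identified up to
  renaming of bound variables, this restricts only the choice of representatives.
\<close>

primrec subst_tm :: "var \<Rightarrow> tm \<Rightarrow> tm \<Rightarrow> tm" where
  "subst_tm x t (Var y) = (if y = x then t else Var y)"
| "subst_tm x t (Fn i ts) = Fn i (map (subst_tm x t) ts)"

primrec subst_fm :: "var \<Rightarrow> tm \<Rightarrow> fm \<Rightarrow> fm" where
  "subst_fm x t (Pred p ts) = Pred p (map (subst_tm x t) ts)"
| "subst_fm x t (Neg A) = Neg (subst_fm x t A)"
| "subst_fm x t (Conj A B) = Conj (subst_fm x t A) (subst_fm x t B)"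
| "subst_fm x t (Disj A B) = Disj (subst_fm x t A) (subst_fm x t B)"
| "subst_fm x t (Forall y A) = Forall y (if y = x then A else subst_fm x t A)"
| "subst_fm x t (Exists y A) = Exists y (if y = x then A else subst_fm x t A)"

primrec free_for :: "tm \<Rightarrow> var \<Rightarrow> fm \<Rightarrow> bool" where
  "free_for t x (Pred p ts) \<longleftrightarrow> True"
| "free_for t x (Neg A) \<longleftrightarrow> free_for t x A"
| "free_for t x (Conj A B) \<longleftrightarrow> free_for t x A \<and> free_for t x B"
| "free_for t x (Disj A B) \<longleftrightarrow> free_for t x A \<and> free_for t x B"
| "free_for t x (Forall y A) \<longleftrightarrow> x \<notin> fv_fm (Forall y A) \<or> (y \<notin> fv_tm t \<and> free_for t x A)"
| "free_for t x (Exists y A) \<longleftrightarrow> x \<notin> fv_fm (Exists y A) \<or> (y \<notin> fv_tm t \<and> free_for t x A)"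

definition subst_mat :: "var \<Rightarrow> tm \<Rightarrow> matrix \<Rightarrow> matrix" where
  "subst_mat x t M = fimage (fimage (subst_fm x t)) M"

definition free_for_mat :: "tm \<Rightarrow> var \<Rightarrow> matrix \<Rightarrow> bool" where
  "free_for_mat t x M \<longleftrightarrow> (\<forall>G\<in>fset M. \<forall>A\<in>fset G. free_for t x A)"

text \<open>\<open>ren_fm i j n\<close> renames the functional variable (i, n) to (j, n).\<close>

primrec ren_tm :: "nat \<Rightarrow> nat \<Rightarrow> nat \<Rightarrow> tm \<Rightarrow> tm" where
  "ren_tm i j n (Var x) = Var x"
| "ren_tm i j n (Fn k ts) = Fn (if k = i \<and> length ts = n then j else k) (map (ren_tm i j n) ts)"

primrec ren_fm :: "nat \<Rightarrow> nat \<Rightarrow> nat \<Rightarrow> fm \<Rightarrow> fm" where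
  "ren_fm i j n (Pred p ts) = Pred p (map (ren_tm i j n) ts)"
| "ren_fm i j n (Neg A) = Neg (ren_fm i j n A)"
| "ren_fm i j n (Conj A B) = Conj (ren_fm i j n A) (ren_fm i j n B)"
| "ren_fm i j n (Disj A B) = Disj (ren_fm i j n A) (ren_fm i j n B)"
| "ren_fm i j n (Forall x A) = Forall x (ren_fm i j n A)"
| "ren_fm i j n (Exists x A) = Exists x (ren_fm i j n A)"

definition ren_mat :: "nat \<Rightarrow> nat \<Rightarrow> nat \<Rightarrow> matrix \<Rightarrow> matrix" where
  "ren_mat i j n M = fimage (fimage (ren_fm i j n)) M"


subsection \<open>Renaming of bound variables, and data\<close>

inductive rename_fm :: "fm \<Rightarrow> fm \<Rightarrow> bool" where
  Forall: "\<lbrakk>y \<notin> fv_fm (Forall x A); free_for (Var y) x A\<rbrakk>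
    \<Longrightarrow> rename_fm (Forall x A) (Forall y (subst_fm x (Var y) A))"
| Exists: "\<lbrakk>y \<notin> fv_fm (Exists x A); free_for (Var y) x A\<rbrakk>
    \<Longrightarrow> rename_fm (Exists x A) (Exists y (subst_fm x (Var y) A))"
| in_Neg: "rename_fm A A' \<Longrightarrow> rename_fm (Neg A) (Neg A')"
| in_Conj1: "rename_fm A A' \<Longrightarrow> rename_fm (Conj A B) (Conj A' B)"
| in_Conj2: "rename_fm B B' \<Longrightarrow> rename_fm (Conj A B) (Conj A B')"
| in_Disj1: "rename_fm A A' \<Longrightarrow> rename_fm (Disj A B) (Disj A' B)"
| in_Disj2: "rename_fm B B' \<Longrightarrow> rename_fm (Disj A B) (Disj A B')"
| in_Forall: "rename_fm A A' \<Longrightarrow> rename_fm (Forall x A) (Forall x A')"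
| in_Exists: "rename_fm A A' \<Longrightarrow> rename_fm (Exists x A) (Exists x A')"

text \<open>
  In the first clause \<open>A\<close> may also belong to \<open>G\<close>, and \<open>finsert A G\<close> to
  \<open>R\<close>. The step then adds a variant instead of replacing one, and its
  inverse renames that variant back so that the two merge; both are identifications of data.
\<close>

inductive rename :: "expr \<Rightarrow> expr \<Rightarrow> bool" where
  quantified: "rename_fm A A'
    \<Longrightarrow> rename (Dat F X (finsert (finsert A G) R)) (Dat F X (finsert (finsert A' G) R))"
| universal: "\<lbrakk>x |\<notin>| X; y |\<notin>| X; y \<notin> fv_mat M; free_for_mat (Var y) x M\<rbrakk>
    \<Longrightarrow> rename (Dat F (finsert x X) M) (Dat F (finsert y X) (subst_mat x (Var y) M))"
| functional: "\<lbrakk>(i, n) |\<notin>| F; (j, n) |\<notin>| F; (j, n) \<notin> funs_mat M\<rbrakk>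
    \<Longrightarrow> rename (Dat (finsert (i, n) F) X M) (Dat (finsert (j, n) F) X (ren_mat i j n M))"

quotient_type datum = expr / "equivclp rename"
  by (rule equivp_evquivclp)

lift_definition Datum :: "fvar fset \<Rightarrow> var fset \<Rightarrow> matrix \<Rightarrow> datum" is Dat .

definition bottom :: datum where
  "bottom = Datum {||} {||} {||}"


section \<open>Semantics\<close>

primrec eval_tm :: "(nat \<Rightarrow> 'u list \<Rightarrow> 'u) \<Rightarrow> (var \<Rightarrow> 'u) \<Rightarrow> tm \<Rightarrow> 'u" where
  "eval_tm I v (Var x) = v x"
| "eval_tm I v (Fn i ts) = I i (map (eval_tm I v) ts)"

primrec holds ::
  "'u set \<Rightarrow> (nat \<Rightarrow> 'u list \<Rightarrow> bool) \<Rightarrow> (nat \<Rightarrow> 'u list \<Rightarrow> 'u) \<Rightarrow> (var \<Rightarrow> 'u) \<Rightarrow> fm \<Rightarrow> bool" where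
  "holds D P I v (Pred p ts) \<longleftrightarrow> P p (map (eval_tm I v) ts)"
| "holds D P I v (Neg A) \<longleftrightarrow> \<not> holds D P I v A"
| "holds D P I v (Conj A B) \<longleftrightarrow> holds D P I v A \<and> holds D P I v B"
| "holds D P I v (Disj A B) \<longleftrightarrow> holds D P I v A \<or> holds D P I v B"
| "holds D P I v (Forall x A) \<longleftrightarrow> (\<forall>d\<in>D. holds D P I (v(x := d)) A)"
| "holds D P I v (Exists x A) \<longleftrightarrow> (\<exists>d\<in>D. holds D P I (v(x := d)) A)"

definition closed_on :: "'u set \<Rightarrow> (nat \<Rightarrow> 'u list \<Rightarrow> 'u) \<Rightarrow> bool" where
  "closed_on D I \<longleftrightarrow> (\<forall>i ds. set ds \<subseteq> D \<longrightarrow> I i ds \<in> D)"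

definition is_interpretation ::
  "'u set \<Rightarrow> (nat \<Rightarrow> 'u list \<Rightarrow> 'u) \<Rightarrow> (var \<Rightarrow> 'u) \<Rightarrow> bool" where
  "is_interpretation D I v \<longleftrightarrow> D \<noteq> {} \<and> closed_on D I \<and> range v \<subseteq> D"

fun verifies ::
  "'u set \<Rightarrow> (nat \<Rightarrow> 'u list \<Rightarrow> bool) \<Rightarrow> (nat \<Rightarrow> 'u list \<Rightarrow> 'u) \<Rightarrow> (var \<Rightarrow> 'u) \<Rightarrow> expr \<Rightarrow> bool" where
  "verifies D P I v (Dat F X M) \<longleftrightarrow>
    (\<exists>J. closed_on D J \<and> (\<forall>i ds. (i, length ds) |\<notin>| F \<longrightarrow> J i ds = I i ds) \<and>
      (\<forall>w. range w \<subseteq> D \<and> (\<forall>x. x |\<notin>| X \<longrightarrow> w x = v x) \<longrightarrow>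
        (\<exists>G\<in>fset M. \<forall>A\<in>fset G. holds D P J w A)))"

text \<open>
  The domains range over the non-empty subsets of the type \<open>'u\<close>, since HOL cannot
  quantify over types. For every infinite \<open>'u\<close>, being unsatisfiable over these domains
  is implied by being unsatisfiable over all domains.
\<close>

definition satisfiable_expr :: "'u itself \<Rightarrow> expr \<Rightarrow> bool" where
  "satisfiable_expr U e \<longleftrightarrow>
    (\<exists>(D :: 'u set) P I v. is_interpretation D I v \<and> verifies D P I v e)"


section \<open>Standard data\<close>

text \<open>
  The occurrences of functional terms, each paired with the set of variables that are bound by
  the quantifiers in whose scope the occurrence lies.
\<close>

fun fterms_tm :: "tm \<Rightarrow> tm set" where
  "fterms_tm (Var x) = {}"
| "fterms_tm (Fn i ts) = insert (Fn i ts) (\<Union>t\<in>set ts. fterms_tm t)"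

primrec fterms_fm :: "fm \<Rightarrow> (var set \<times> tm) set" where
  "fterms_fm (Pred p ts) = {{}} \<times> (\<Union>t\<in>set ts. fterms_tm t)"
| "fterms_fm (Neg A) = fterms_fm A"
| "fterms_fm (Conj A B) = fterms_fm A \<union> fterms_fm B"
| "fterms_fm (Disj A B) = fterms_fm A \<union> fterms_fm B"
| "fterms_fm (Forall x A) = apfst (insert x) ` fterms_fm A"
| "fterms_fm (Exists x A) = apfst (insert x) ` fterms_fm A"

definition fterms_mat :: "matrix \<Rightarrow> (var set \<times> tm) set" where
  "fterms_mat M = (\<Union>G\<in>fset M. \<Union>A\<in>fset G. fterms_fm A)"

text \<open>
  The last condition keeps apart a universal prefix variable and a homonymous variable bound by a
  quantifier of the matrix: (Ef)(x): \<open>\<forall>x P(f x)\<close> is not standard, just like its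
  variant (Ef)(x): \<open>\<forall>y P(f y)\<close>.
\<close>

fun standard_expr :: "expr \<Rightarrow> bool" where
  "standard_expr (Dat F X M) \<longleftrightarrow>
    funs_mat M \<subseteq> fset F \<and>
    (\<forall>B i ts. (B, Fn i ts) \<in> fterms_mat M \<longrightarrow> set ts \<subseteq> range Var) \<and>
    (\<exists>xs. distinct xs \<and> set xs = fset X \<and>
      (\<forall>B i ts. (B, Fn i ts) \<in> fterms_mat M \<longrightarrow>
        (\<exists>k \<le> length xs. ts = map Var (take k xs) \<and> set (take k xs) \<inter> B = {})))"


section \<open>The calculus QDC\<close>

text \<open>
  Writing \<open>A, G / R\<close> as \<open>finsert (finsert A G) R\<close>, the inductive
  predicate \<open>analytic\<close> lists the G-rules read from left to right. In the quantifier
  rules and in Gen, \<open>Fn g (map Var xs)\<close> is g applied to the universal prefix listed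
  in the order xs. The lists F,g and x,y of the prefixes are read as unions, like the list G,A.
\<close>

inductive analytic :: "expr \<Rightarrow> expr \<Rightarrow> bool" where
  Conj: "analytic (Dat F X (finsert (finsert (Conj A B) G) R))
    (Dat F X (finsert (finsert A (finsert B G)) R))"
| Disj: "analytic (Dat F X (finsert (finsert (Disj A B) G) R))
    (Dat F X (finsert (finsert A G) (finsert (finsert B G) R)))"
| Neg_Neg: "analytic (Dat F X (finsert (finsert (Neg (Neg A)) G) R))
    (Dat F X (finsert (finsert A G) R))"
| Neg_Disj: "analytic (Dat F X (finsert (finsert (Neg (Disj A B)) G) R))
    (Dat F X (finsert (finsert (Neg A) (finsert (Neg B) G)) R))"
| Neg_Conj: "analytic (Dat F X (finsert (finsert (Neg (Conj A B)) G) R))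
    (Dat F X (finsert (finsert (Neg A) G) (finsert (finsert (Neg B) G) R)))"
| Forall: "\<lbrakk>y \<notin> fv_set G; y \<notin> fv_mat R\<rbrakk>
    \<Longrightarrow> analytic (Dat F X (finsert (finsert (Forall y A) G) R))
      (Dat F (finsert y X) (finsert (finsert A G) R))"
| Neg_Exists: "\<lbrakk>y \<notin> fv_set G; y \<notin> fv_mat R\<rbrakk>
    \<Longrightarrow> analytic (Dat F X (finsert (finsert (Neg (Exists y A)) G) R))
      (Dat F (finsert y X) (finsert (finsert (Neg A) G) R))"
| Exists: "\<lbrakk>distinct xs; set xs = fset X; (g, length xs) \<notin> funs_mat (finsert (finsert A G) R);
      free_for (Fn g (map Var xs)) y A\<rbrakk>
    \<Longrightarrow> analytic (Dat F X (finsert (finsert (Exists y A) G) R))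
      (Dat (finsert (g, length xs) F) X
        (finsert (finsert (subst_fm y (Fn g (map Var xs)) A) G) R))"
| Neg_Forall: "\<lbrakk>distinct xs; set xs = fset X; (g, length xs) \<notin> funs_mat (finsert (finsert A G) R);
      free_for (Fn g (map Var xs)) y A\<rbrakk>
    \<Longrightarrow> analytic (Dat F X (finsert (finsert (Neg (Forall y A)) G) R))
      (Dat (finsert (g, length xs) F) X
        (finsert (finsert (Neg (subst_fm y (Fn g (map Var xs)) A)) G) R))"

inductive G_rule :: "expr \<Rightarrow> expr \<Rightarrow> bool" where
  analytic: "analytic a b \<Longrightarrow> G_rule a b"
| synthetic: "analytic a b \<Longrightarrow> G_rule b a"

inductive N_rule :: "expr \<Rightarrow> expr \<Rightarrow> bool" where
  NC: "N_rule (Dat F X (finsert (finsert A (finsert (Neg A) G)) R)) (Dat F X R)"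
| EM: "N_rule (Dat F X (finsert G R))
    (Dat F X (finsert (finsert A G) (finsert (finsert (Neg A) G) R)))"

text \<open>
  In Inst the variable y leaves the universal prefix, so \<open>\<alpha>(t)\<close> replaces all its
  free occurrences. In Gen the schema \<open>\<alpha>(.)\<close> is the matrix M with place holder z;
  t may occur in M itself, so that not all occurrences of t need be generalized. In both rules
  t may contain variables of the prefix.
\<close>

inductive S_rule :: "expr \<Rightarrow> expr \<Rightarrow> bool" where
  Del: "S_rule (Dat F X (finsert (G |\<union>| H) R)) (Dat F X (finsert G R))"
| Exp: "S_rule (Dat F X R) (Dat F X (finsert G R))"
| Inst: "free_for_mat t y M
    \<Longrightarrow> S_rule (Dat F (finsert y X) M) (Dat F X (subst_mat y t M))"
| Gen: "\<lbrakk>distinct xs; set xs = fset X; (g, length xs) |\<notin>| F; (g, length xs) \<notin> funs_mat M;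
      free_for_mat t z M; free_for_mat (Fn g (map Var xs)) z M\<rbrakk>
    \<Longrightarrow> S_rule (Dat F X (subst_mat z t M))
      (Dat (finsert (g, length xs) F) X (subst_mat z (Fn g (map Var xs)) M))"
| EVE: "g \<notin> funs_mat M \<Longrightarrow> S_rule (Dat (finsert g F) X M) (Dat F X M)"
| IVU: "fset Y \<inter> fv_mat M = {} \<Longrightarrow> S_rule (Dat F X M) (Dat F (X |\<union>| Y) M)"

definition inferable :: "datum \<Rightarrow> datum \<Rightarrow> bool" where
  "inferable d e \<longleftrightarrow> (\<exists>F X M F' X' M'. d = Datum F X M \<and> e = Datum F' X' M' \<and>
    (G_rule (Dat F X M) (Dat F' X' M') \<or> N_rule (Dat F X M) (Dat F' X' M') \<or>
     S_rule (Dat F X M) (Dat F' X' M')))"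

definition QDC_deduction :: "datum list \<Rightarrow> datum \<Rightarrow> datum \<Rightarrow> bool" where
  "QDC_deduction ds d e \<longleftrightarrow> ds \<noteq> [] \<and> hd ds = d \<and> last ds = e \<and> successively inferable ds"

definition QDC_refutable :: "datum \<Rightarrow> bool" where
  "QDC_refutable d \<longleftrightarrow> (\<exists>ds. QDC_deduction ds d bottom)"


section \<open>Semantic notions and standardness are invariant under renaming\<close>

lemma subst_tm_fresh: "x \<notin> fv_tm s \<Longrightarrow> subst_tm x t s = s"
  by (induction s) (auto intro: map_idI)

lemma subst_fm_fresh: "x \<notin> fv_fm A \<Longrightarrow> subst_fm x t A = A"
  by (induction A) (auto intro!: map_idI subst_tm_fresh)

lemma fv_subst_tm: "fv_tm (subst_tm x t s) = (fv_tm s - {x}) \<union> (if x \<in> fv_tm s then fv_tm t else {})"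
  by (induction s) (auto split: if_splits)

lemma subst_tm_inverse: "y \<notin> fv_tm s - {x} \<Longrightarrow> subst_tm y (Var x) (subst_tm x (Var y) s) = s"
  by (induction s) (auto intro!: map_idI)

lemma fv_subst_fm_var:
  "free_for (Var y) x A \<Longrightarrow> fv_fm (subst_fm x (Var y) A) = (if x \<in> fv_fm A then insert y (fv_fm A - {x}) else fv_fm A)"
proof (induction A)
  case (Pred p ts)
  then show ?case by (auto simp: fv_subst_tm split: if_splits)
next
  case (Forall z A)
  then show ?case by (cases "x \<in> fv_fm A") (auto simp: subst_fm_fresh)
next
  case (Exists z A)
  then show ?case by (cases "x \<in> fv_fm A") (auto simp: subst_fm_fresh)
qed auto

lemma subst_fm_inverse:
  "\<lbrakk>y \<notin> fv_fm A - {x}; free_for (Var y) x A\<rbrakk> \<Longrightarrow>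
    subst_fm y (Var x) (subst_fm x (Var y) A) = A \<and> free_for (Var x) y (subst_fm x (Var y) A)"
proof (induction A)
  case (Pred p ts)
  then show ?case by (auto intro!: map_idI subst_tm_inverse)
next
  case (Forall z A)
  show ?case
  proof (cases "x \<in> fv_fm (Forall z A)")
    case True
    with Forall show ?thesis by (auto simp: fv_subst_fm_var)
  next
    case False
    with Forall.prems have "y \<notin> fv_fm (Forall z A)" by auto
    with False show ?thesis
      using subst_fm_fresh[of x "Forall z A" "Var y"] subst_fm_fresh[of y "Forall z A" "Var x"]
      by (auto simp del: subst_fm.simps)
  qed
next
  case (Exists z A)
  show ?case
  proof (cases "x \<in> fv_fm (Exists z A)")
    case True
    with Exists show ?thesis by (auto simp: fv_subst_fm_var)
  next
    case False
    with Exists.prems have "y \<notin> fv_fm (Exists z A)" by auto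
    with False show ?thesis
      using subst_fm_fresh[of x "Exists z A" "Var y"] subst_fm_fresh[of y "Exists z A" "Var x"]
      by (auto simp del: subst_fm.simps)
  qed
qed auto

lemma rename_fm_sym: "rename_fm A B \<Longrightarrow> rename_fm B A"
proof (induction rule: rename_fm.induct)
  case (Forall y x A)
  have "rename_fm (Forall y (subst_fm x (Var y) A))
     (Forall x (subst_fm y (Var x) (subst_fm x (Var y) A)))"
    using Forall subst_fm_inverse[of y A x] fv_subst_fm_var[of y x A]
    by (intro rename_fm.Forall) auto
  then show ?case using Forall subst_fm_inverse[of y A x] by auto
next
  case (Exists y x A)
  have "rename_fm (Exists y (subst_fm x (Var y) A))
     (Exists x (subst_fm y (Var x) (subst_fm x (Var y) A)))"
    using Exists subst_fm_inverse[of y A x] fv_subst_fm_var[of y x A]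
    by (intro rename_fm.Exists) auto
  then show ?case using Exists subst_fm_inverse[of y A x] by auto
qed (auto intro: rename_fm.intros)

lemma ren_tm_inverse: "(j, n) \<notin> funs_tm s \<Longrightarrow> ren_tm j i n (ren_tm i j n s) = s"
  by (induction s) (auto intro!: map_idI)

lemma ren_fm_inverse: "(j, n) \<notin> funs_fm A \<Longrightarrow> ren_fm j i n (ren_fm i j n A) = A"
  by (induction A) (auto intro!: map_idI ren_tm_inverse)

lemma funs_ren_tm: "funs_tm (ren_tm i j n s) = (\<lambda>f. if f = (i, n) then (j, n) else f) ` funs_tm s"
  by (induction s) (auto simp: image_UN)

lemma funs_ren_fm: "funs_fm (ren_fm i j n A) = (\<lambda>f. if f = (i, n) then (j, n) else f) ` funs_fm A"
  by (induction A) (auto simp: funs_ren_tm image_UN image_Un)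

lemma fimage_fimage_id:
  "(\<And>G A. G |\<in>| M \<Longrightarrow> A |\<in>| G \<Longrightarrow> f (g A) = A)
    \<Longrightarrow> fimage (fimage f) (fimage (fimage g) M) = M"
proof -
  assume *: "\<And>G A. G |\<in>| M \<Longrightarrow> A |\<in>| G \<Longrightarrow> f (g A) = A"
  have "fimage f (fimage g G) = G" if "G |\<in>| M" for G
    using *[OF that] by (simp add: fset.map_comp comp_def fset.map_ident_strong)
  then show ?thesis by (simp add: fset.map_comp comp_def fset.map_ident_strong)
qed

lemma rename_sym: "rename d e \<Longrightarrow> rename e d"
proof (induction rule: rename.induct)
  case quantified
  then show ?case by (rule rename.quantified[OF rename_fm_sym])
next
  case (universal x X y M F)
  have *: "y \<notin> fv_fm A" "free_for (Var y) x A" if "G |\<in>| M" "A |\<in>| G" for A G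
    using universal.hyps(3,4) that by (auto simp: fv_mat_def fv_set_def free_for_mat_def)
  have inv: "subst_mat y (Var x) (subst_mat x (Var y) M) = M"
    unfolding subst_mat_def using * subst_fm_inverse by (intro fimage_fimage_id) auto
  have "x \<notin> fv_mat (subst_mat x (Var y) M)"
  proof (cases "x = y")
    case True
    have "subst_fm x (Var x) A = A" if "G |\<in>| M" "A |\<in>| G" for A G
      using *[OF that] True subst_fm_fresh by auto
    with True * show ?thesis by (auto simp: fv_mat_def fv_set_def subst_mat_def)
  next
    case False
    with * show ?thesis
      by (auto simp: fv_mat_def fv_set_def subst_mat_def fv_subst_fm_var split: if_splits)
  qed
  moreover have "free_for_mat (Var x) y (subst_mat x (Var y) M)"
    using * subst_fm_inverse by (auto simp: free_for_mat_def subst_mat_def)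
  ultimately have "rename (Dat F (finsert y X) (subst_mat x (Var y) M))
      (Dat F (finsert x X) (subst_mat y (Var x) (subst_mat x (Var y) M)))"
    by (intro rename.universal universal.hyps)
  then show ?case unfolding inv .
next
  case (functional i n F j M X)
  have *: "(j, n) \<notin> funs_fm A" if "G |\<in>| M" "A |\<in>| G" for A G
    using functional.hyps(3) that by (auto simp: funs_mat_def)
  have inv: "ren_mat j i n (ren_mat i j n M) = M"
    unfolding ren_mat_def using * ren_fm_inverse by (intro fimage_fimage_id) auto
  have "(i, n) \<notin> funs_mat (ren_mat i j n M)"
    using * by (auto simp: funs_mat_def ren_mat_def funs_ren_fm split: if_splits)
  then have "rename (Dat (finsert (j, n) F) X (ren_mat i j n M))
      (Dat (finsert (i, n) F) X (ren_mat j i n (ren_mat i j n M)))"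
    by (intro rename.functional functional.hyps)
  then show ?case unfolding inv .
qed

lemma rename_cong:
  assumes "\<And>d e. rename d e \<Longrightarrow> P d \<Longrightarrow> P e" and "equivclp rename d e"
  shows "P d \<longleftrightarrow> P e"
  using assms(2)
proof (induction rule: equivclp_induct)
  case (step y z)
  then show ?case using assms(1) rename_sym by blast
qed simp


subsection \<open>Semantics\<close>

lemma eval_subst_tm: "eval_tm I v (subst_tm x t s) = eval_tm I (v(x := eval_tm I v t)) s"
  by (induction s) (simp_all add: comp_def cong: map_cong)

lemma eval_tm_cong: "(\<And>x. x \<in> fv_tm s \<Longrightarrow> v x = w x) \<Longrightarrow> eval_tm I v s = eval_tm I w s"
proof (induction s)
  case (Fn i ts)
  then have "map (eval_tm I v) ts = map (eval_tm I w) ts"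
    unfolding map_eq_conv by (metis UN_I fv_tm.simps(2))
  then show ?case by (simp only: eval_tm.simps)
qed simp

lemma map_eval_tm_cong:
  "(\<And>x. x \<in> (\<Union>t\<in>set ts. fv_tm t) \<Longrightarrow> v x = w x) \<Longrightarrow> map (eval_tm I v) ts = map (eval_tm I w) ts"
  by (auto intro!: eval_tm_cong)

lemma holds_cong: "(\<And>x. x \<in> fv_fm A \<Longrightarrow> v x = w x) \<Longrightarrow> holds D P I v A \<longleftrightarrow> holds D P I w A"
proof (induction A arbitrary: v w)
  case (Pred p ts)
  then have "map (eval_tm I v) ts = map (eval_tm I w) ts"
    by (intro map_eval_tm_cong) simp
  then show ?case by (simp only: holds.simps)
next
  case (Forall x A)
  have "holds D P I (v(x := d)) A = holds D P I (w(x := d)) A" for d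
    using Forall.prems by (intro Forall.IH) auto
  then show ?case by simp
next
  case (Exists x A)
  have "holds D P I (v(x := d)) A = holds D P I (w(x := d)) A" for d
    using Exists.prems by (intro Exists.IH) auto
  then show ?case by simp
next
  case (Conj A B)
  have "holds D P I v A = holds D P I w A" "holds D P I v B = holds D P I w B"
    using Conj.prems by (auto intro!: Conj.IH)
  then show ?case by simp
next
  case (Disj A B)
  have "holds D P I v A = holds D P I w A" "holds D P I v B = holds D P I w B"
    using Disj.prems by (auto intro!: Disj.IH)
  then show ?case by simp
next
  case (Neg A)
  have "holds D P I v A = holds D P I w A"
    using Neg.prems by (intro Neg.IH) simp
  then show ?case by simp
qed

lemma holds_subst_fm:
  "free_for t x A \<Longrightarrow> holds D P I v (subst_fm x t A) \<longleftrightarrow> holds D P I (v(x := eval_tm I v t)) A"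
proof (induction A arbitrary: v)
  case (Pred p ts)
  then show ?case by (simp only: subst_fm.simps holds.simps map_map comp_def eval_subst_tm)
next
  case (Forall y A)
  show ?case
  proof (cases "x \<in> fv_fm (Forall y A)")
    case True
    have "eval_tm I (v(y := d)) t = eval_tm I v t" for d
      using True Forall.prems by (intro eval_tm_cong) auto
    moreover have "x \<noteq> y" "free_for t x A" using True Forall.prems by auto
    ultimately have "holds D P I (v(y := d)) (subst_fm x t A)
        \<longleftrightarrow> holds D P I (v(x := eval_tm I v t, y := d)) A" for d
      using Forall.IH[of "v(y := d)"] by (metis fun_upd_twist)
    with \<open>x \<noteq> y\<close> show ?thesis
      unfolding subst_fm.simps holds.simps by (metis (full_types))
  next
    case False
    then have "holds D P I v (Forall y A) \<longleftrightarrow> holds D P I (v(x := eval_tm I v t)) (Forall y A)"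
      by (intro holds_cong) auto
    then show ?thesis by (simp only: subst_fm_fresh[OF False])
  qed
next
  case (Exists y A)
  show ?case
  proof (cases "x \<in> fv_fm (Exists y A)")
    case True
    have "eval_tm I (v(y := d)) t = eval_tm I v t" for d
      using True Exists.prems by (intro eval_tm_cong) auto
    moreover have "x \<noteq> y" "free_for t x A" using True Exists.prems by auto
    ultimately have "holds D P I (v(y := d)) (subst_fm x t A)
        \<longleftrightarrow> holds D P I (v(x := eval_tm I v t, y := d)) A" for d
      using Exists.IH[of "v(y := d)"] by (metis fun_upd_twist)
    with \<open>x \<noteq> y\<close> show ?thesis
      unfolding subst_fm.simps holds.simps by (metis (full_types))
  next
    case False
    then have "holds D P I v (Exists y A) \<longleftrightarrow> holds D P I (v(x := eval_tm I v t)) (Exists y A)"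
      by (intro holds_cong) auto
    then show ?thesis by (simp only: subst_fm_fresh[OF False])
  qed
qed auto

lemma holds_rename_fm: "rename_fm A B \<Longrightarrow> holds D P I v A \<longleftrightarrow> holds D P I v B"
proof (induction arbitrary: v rule: rename_fm.induct)
  case (Forall y x A)
  have "holds D P I (v(y := d)) (subst_fm x (Var y) A) = holds D P I (v(x := d)) A" for d
    using Forall by (simp add: holds_subst_fm) (intro holds_cong, auto)
  then show ?case by simp
next
  case (Exists y x A)
  have "holds D P I (v(y := d)) (subst_fm x (Var y) A) = holds D P I (v(x := d)) A" for d
    using Exists by (simp add: holds_subst_fm) (intro holds_cong, auto)
  then show ?case by simp
qed auto

lemma eval_ren_tm:
  assumes "\<And>ds. length ds = n \<Longrightarrow> J j ds = I i ds"
    and "\<And>k ds. (k, length ds) \<noteq> (i, n) \<Longrightarrow> (k, length ds) \<noteq> (j, n) \<Longrightarrow> J k ds = I k ds"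
  shows "(j, n) \<notin> funs_tm s \<Longrightarrow> eval_tm J v (ren_tm i j n s) = eval_tm I v s"
proof (induction s)
  case (Fn k ts)
  then have "map (eval_tm J v \<circ> ren_tm i j n) ts = map (eval_tm I v) ts" by auto
  then have "map (eval_tm J v) (map (ren_tm i j n) ts) = map (eval_tm I v) ts" by (simp only: map_map)
  with Fn.prems show ?case by (simp only: ren_tm.simps eval_tm.simps) (auto simp: assms)
qed simp

lemma holds_ren_fm:
  assumes "\<And>ds. length ds = n \<Longrightarrow> J j ds = I i ds"
    and "\<And>k ds. (k, length ds) \<noteq> (i, n) \<Longrightarrow> (k, length ds) \<noteq> (j, n) \<Longrightarrow> J k ds = I k ds"
  shows "(j, n) \<notin> funs_fm A \<Longrightarrow> holds D P J v (ren_fm i j n A) \<longleftrightarrow> holds D P I v A"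
proof (induction A arbitrary: v)
  case (Pred p ts)
  then have "map (eval_tm J v \<circ> ren_tm i j n) ts = map (eval_tm I v) ts"
    using eval_ren_tm[of n J j I i, OF assms] by auto
  then show ?case by (simp only: ren_fm.simps holds.simps map_map)
qed auto

lemma satisfiable_expr_rename: "rename d e \<Longrightarrow> satisfiable_expr U d \<Longrightarrow> satisfiable_expr U e"
proof (induction rule: rename.induct)
  case (quantified A A' F X G R)
  then show ?case by (simp add: satisfiable_expr_def holds_rename_fm[OF quantified(1)])
next
  case (universal x X y M F)
  have ff: "free_for (Var y) x A" if "G |\<in>| M" "A |\<in>| G" for A G
    using universal that by (auto simp: free_for_mat_def)
  from universal.prems obtain D :: "'a set" and P I v J where
    i: "is_interpretation D I v" and J: "closed_on D J" "\<forall>i ds. (i, length ds) |\<notin>| F \<longrightarrow> J i ds = I i ds"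
    and M: "\<And>w. range w \<subseteq> D \<Longrightarrow> \<forall>z. z |\<notin>| finsert x X \<longrightarrow> w z = v z \<Longrightarrow>
      \<exists>G\<in>fset M. \<forall>A\<in>fset G. holds D P J w A"
    unfolding satisfiable_expr_def verifies.simps by blast
  have "\<exists>G\<in>fset (subst_mat x (Var y) M). \<forall>A\<in>fset G. holds D P J w A"
    if w: "range w \<subseteq> D" "\<forall>z. z |\<notin>| finsert y X \<longrightarrow> w z = v z" for w
  proof -
    let ?w = "\<lambda>z. if z = x then w y else if z = y then v y else w z"
    have r: "range v \<subseteq> D" using i by (simp add: is_interpretation_def)
    have "range ?w \<subseteq> D" using w(1) r by (auto simp: image_subset_iff)
    moreover have "\<forall>z. z |\<notin>| finsert x X \<longrightarrow> ?w z = v z" using w(2) by auto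
    ultimately obtain G where G: "G |\<in>| M" "\<forall>A\<in>fset G. holds D P J ?w A" using M by blast
    have "holds D P J w (subst_fm x (Var y) A)" if A: "A |\<in>| G" for A
    proof -
      have "y \<notin> fv_fm A" using universal G(1) A by (auto simp: fv_mat_def fv_set_def)
      then have "holds D P J (w(x := w y)) A = holds D P J ?w A"
        by (intro holds_cong) auto
      with G A show ?thesis by (simp add: holds_subst_fm[OF ff[OF G(1) A]])
    qed
    with G(1) show ?thesis by (auto simp: subst_mat_def)
  qed
  with i J show ?case unfolding satisfiable_expr_def verifies.simps by blast
next
  case (functional i n F j M X)
  from functional.prems obtain D :: "'a set" and P I v J where
    int: "is_interpretation D I v" and J: "closed_on D J"
    "\<forall>k ds. (k, length ds) |\<notin>| finsert (i, n) F \<longrightarrow> J k ds = I k ds"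
    and M: "\<And>w. range w \<subseteq> D \<Longrightarrow> \<forall>z. z |\<notin>| X \<longrightarrow> w z = v z \<Longrightarrow>
      \<exists>G\<in>fset M. \<forall>A\<in>fset G. holds D P J w A"
    unfolding satisfiable_expr_def verifies.simps by blast
  define K where "K k ds = (if (k, length ds) = (j, n) then J i ds
    else if (k, length ds) = (i, n) then I i ds else J k ds)" for k ds
  have K: "holds D P K w (ren_fm i j n A) = holds D P J w A" if "(j, n) \<notin> funs_fm A" for w A
    using that by (intro holds_ren_fm) (auto simp: K_def)
  have "closed_on D K" using J(1) int by (auto simp: closed_on_def is_interpretation_def K_def)
  moreover have "\<forall>k ds. (k, length ds) |\<notin>| finsert (j, n) F \<longrightarrow> K k ds = I k ds"
    using J(2) by (auto simp: K_def)
  moreover have "\<exists>G\<in>fset (ren_mat i j n M). \<forall>A\<in>fset G. holds D P K w A"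
    if w: "range w \<subseteq> D" "\<forall>z. z |\<notin>| X \<longrightarrow> w z = v z" for w
  proof -
    obtain G where G: "G |\<in>| M" "\<forall>A\<in>fset G. holds D P J w A" using M[OF w] by blast
    have "(j, n) \<notin> funs_fm A" if "A |\<in>| G" for A
      using functional G(1) that by (auto simp: funs_mat_def)
    with G K have "\<forall>A\<in>fset (fimage (ren_fm i j n) G). holds D P K w A" by auto
    with G(1) show ?thesis by (auto simp: ren_mat_def)
  qed
  ultimately show ?case using int unfolding satisfiable_expr_def verifies.simps by blast
qed

lemma satisfiable_expr_cong: "equivclp rename d e \<Longrightarrow> satisfiable_expr U d \<longleftrightarrow> satisfiable_expr U e"
  by (rule rename_cong[OF satisfiable_expr_rename])


subsection \<open>Standardness\<close>

definition ok_args :: "var set \<Rightarrow> var list \<Rightarrow> fm \<Rightarrow> bool" where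
  "ok_args C xs A \<longleftrightarrow> (\<forall>(B, s)\<in>fterms_fm A. \<exists>i. \<exists>k \<le> length xs.
    s = Fn i (map Var (take k xs)) \<and> set (take k xs) \<inter> (B \<union> C) = {})"

lemma fterms_tm_Fn: "s \<in> fterms_tm t \<Longrightarrow> \<exists>i ts. s = Fn i ts"
  by (induction t) auto

lemma fterms_fm_Fn: "(B, s) \<in> fterms_fm A \<Longrightarrow> \<exists>i ts. s = Fn i ts"
  by (induction A arbitrary: B) (auto dest: fterms_tm_Fn)

lemma standard_expr_iff:
  "standard_expr (Dat F X M) \<longleftrightarrow> funs_mat M \<subseteq> fset F \<and>
    (\<exists>xs. distinct xs \<and> set xs = fset X \<and> (\<forall>G\<in>fset M. \<forall>A\<in>fset G. ok_args {} xs A))"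
proof -
  have "(\<forall>G\<in>fset M. \<forall>A\<in>fset G. ok_args {} xs A) \<longleftrightarrow>
    (\<forall>B i ts. (B, Fn i ts) \<in> fterms_mat M \<longrightarrow>
        (\<exists>k \<le> length xs. ts = map Var (take k xs) \<and> set (take k xs) \<inter> B = {}))" (is "?l \<longleftrightarrow> ?r") for xs
  proof
    assume ?l
    then show ?r by (fastforce simp: ok_args_def fterms_mat_def)
  next
    assume r: ?r
    show ?l unfolding ok_args_def
    proof safe
      fix G A B s assume *: "G |\<in>| M" "A |\<in>| G" "(B, s) \<in> fterms_fm A"
      then obtain i ts where "s = Fn i ts" using fterms_fm_Fn by blast
      with * r show "\<exists>i. \<exists>k \<le> length xs. s = Fn i (map Var (take k xs)) \<and> set (take k xs) \<inter> (B \<union> {}) = {}"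
        by (fastforce simp: fterms_mat_def)
    qed
  qed
  moreover have "set ts \<subseteq> range Var" if "ts = map Var (take k xs)" for ts k xs
    using that by auto
  ultimately show ?thesis unfolding standard_expr.simps by blast
qed

lemma ok_args_simps [simp]:
  "ok_args C xs (Neg A) \<longleftrightarrow> ok_args C xs A"
  "ok_args C xs (Conj A B) \<longleftrightarrow> ok_args C xs A \<and> ok_args C xs B"
  "ok_args C xs (Disj A B) \<longleftrightarrow> ok_args C xs A \<and> ok_args C xs B"
  "ok_args C xs (Forall x A) \<longleftrightarrow> ok_args (insert x C) xs A"
  "ok_args C xs (Exists x A) \<longleftrightarrow> ok_args (insert x C) xs A"
  by (simp_all add: ok_args_def ball_Un case_prod_beta)

lemma fterms_subst_tm:
  "fterms_tm (subst_tm x (Var y) s) = subst_tm x (Var y) ` fterms_tm s"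
  by (induction s) (auto simp: image_UN)

lemma fterms_subst_fm:
  "fterms_fm (subst_fm x (Var y) A) =
    (\<lambda>(B, s). (B, if x \<in> B then s else subst_tm x (Var y) s)) ` fterms_fm A"
proof (induction A)
  case (Pred p ts)
  then show ?case by (force simp: fterms_subst_tm)
next
  case (Forall z A)
  then show ?case
    by (cases "z = x") (auto simp: image_image case_prod_beta apfst_def map_prod_def intro!: image_cong)
next
  case (Exists z A)
  then show ?case
    by (cases "z = x") (auto simp: image_image case_prod_beta apfst_def map_prod_def intro!: image_cong)
qed (auto simp: image_Un)

lemma fterms_tm_fv: "s \<in> fterms_tm t \<Longrightarrow> fv_tm s \<subseteq> fv_tm t"
  by (induction t) auto

lemma fterms_fm_fv: "(B, s) \<in> fterms_fm A \<Longrightarrow> fv_tm s \<subseteq> B \<union> fv_fm A"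
  by (induction A arbitrary: B) (auto dest: fterms_tm_fv, blast+)

lemma fterms_free_for:
  "\<lbrakk>free_for (Var y) x A; (B, s) \<in> fterms_fm A; x \<in> fv_tm s; x \<notin> B\<rbrakk> \<Longrightarrow> y \<notin> B"
proof (induction A arbitrary: B)
  case (Forall z A)
  then obtain B' where "B = insert z B'" "(B', s) \<in> fterms_fm A" by auto
  with Forall fterms_fm_fv[of B' s A] show ?case by auto
next
  case (Exists z A)
  then obtain B' where "B = insert z B'" "(B', s) \<in> fterms_fm A" by auto
  with Exists fterms_fm_fv[of B' s A] show ?case by auto
qed auto

lemma ok_args_subst_bound:
  assumes ok: "ok_args (insert x C) xs A" and y: "y \<notin> fv_fm A - {x}"
  shows "ok_args (insert y C) xs (subst_fm x (Var y) A)"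
proof -
  have "\<exists>i. \<exists>k \<le> length xs. subst_tm x (Var y) s = Fn i (map Var (take k xs)) \<and>
      s = Fn i (map Var (take k xs)) \<and> set (take k xs) \<inter> (B \<union> insert y C) = {}"
    if Bs: "(B, s) \<in> fterms_fm A" for B s
  proof -
    from ok Bs obtain i k where k: "k \<le> length xs" "s = Fn i (map Var (take k xs))"
      "set (take k xs) \<inter> (B \<union> insert x C) = {}" unfolding ok_args_def by blast
    then have fv: "fv_tm s = set (take k xs)" by auto
    have "x \<notin> fv_tm s" using fv k by auto
    moreover have "y \<notin> fv_tm s" using fterms_fm_fv[OF Bs] fv k y by auto
    ultimately show ?thesis using k fv subst_tm_fresh[of x s "Var y"] by auto
  qed
  then show ?thesis unfolding ok_args_def fterms_subst_fm by fastforce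
qed

lemma funs_subst_tm_var: "funs_tm (subst_tm x (Var y) s) = funs_tm s"
  by (induction s) auto

lemma funs_subst_fm_var: "funs_fm (subst_fm x (Var y) A) = funs_fm A"
  by (induction A) (auto simp: funs_subst_tm_var)

lemma rename_fm_funs: "rename_fm A B \<Longrightarrow> funs_fm B = funs_fm A"
  by (induction rule: rename_fm.induct) (auto simp: funs_subst_fm_var)

lemma rename_fm_ok_args: "rename_fm A B \<Longrightarrow> ok_args C xs A \<Longrightarrow> ok_args C xs B"
  by (induction arbitrary: C rule: rename_fm.induct) (auto intro!: ok_args_subst_bound)

lemma ok_args_subst_free:
  assumes ok: "ok_args {} xs A" and ff: "free_for (Var y) x A"
  shows "ok_args {} (map (\<lambda>z. if z = x then y else z) xs) (subst_fm x (Var y) A)"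
proof -
  let ?r = "\<lambda>z. if z = x then y else z"
  have "\<exists>i. \<exists>k \<le> length (map ?r xs).
      (if x \<in> B then s else subst_tm x (Var y) s) = Fn i (map Var (take k (map ?r xs))) \<and>
      set (take k (map ?r xs)) \<inter> (B \<union> {}) = {}"
    if Bs: "(B, s) \<in> fterms_fm A" for B s
  proof -
    from ok Bs obtain i k where k: "k \<le> length xs" "s = Fn i (map Var (take k xs))"
      "set (take k xs) \<inter> B = {}" unfolding ok_args_def by fastforce
    have fv: "fv_tm s = set (take k xs)" using k by auto
    have s: "subst_tm x (Var y) s = Fn i (map Var (take k (map ?r xs)))"
      using k by (auto simp: take_map)
    moreover have "subst_tm x (Var y) s = s" if "x \<in> B"
      using that k fv by (intro subst_tm_fresh) auto
    moreover have "set (take k (map ?r xs)) \<inter> B = {}"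
      using k(3) fv fterms_free_for[OF ff Bs] by (auto simp: take_map)
    ultimately show ?thesis using k(1) by (intro exI[of _ i] exI[of _ k]) auto
  qed
  then show ?thesis unfolding ok_args_def fterms_subst_fm by fastforce
qed

lemma fterms_ren_tm: "fterms_tm (ren_tm i j n s) = ren_tm i j n ` fterms_tm s"
  by (induction s) (auto simp: image_UN)

lemma fterms_ren_fm: "fterms_fm (ren_fm i j n A) = apsnd (ren_tm i j n) ` fterms_fm A"
proof (induction A)
  case (Pred p ts)
  then show ?case by (force simp: fterms_ren_tm)
next
  case (Forall z A)
  then show ?case by (simp add: image_image)
next
  case (Exists z A)
  then show ?case by (simp add: image_image)
qed (auto simp: image_Un)

lemma ok_args_ren: "ok_args C xs A \<Longrightarrow> ok_args C xs (ren_fm i j n A)"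
  unfolding ok_args_def fterms_ren_fm by (fastforce simp: comp_def)

lemma standard_expr_rename: "rename d e \<Longrightarrow> standard_expr d \<Longrightarrow> standard_expr e"
proof (induction rule: rename.induct)
  case (quantified A A' F X G R)
  then show ?case
    using rename_fm_funs[of A A'] rename_fm_ok_args[of A A' "{}"]
    unfolding standard_expr_iff funs_mat_def by auto
next
  case (universal x X y M F)
  from universal.prems obtain xs where xs: "distinct xs" "set xs = fset (finsert x X)"
    "\<And>G A. G |\<in>| M \<Longrightarrow> A |\<in>| G \<Longrightarrow> ok_args {} xs A" and F: "funs_mat M \<subseteq> fset F"
    unfolding standard_expr_iff by blast
  let ?r = "\<lambda>z. if z = x then y else z"
  have "distinct (map ?r xs)" using xs universal.hyps by (auto simp: distinct_map inj_on_def)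
  moreover have "set (map ?r xs) = fset (finsert y X)"
    using xs(2) universal.hyps by (auto simp: image_iff)
  moreover have "\<forall>G\<in>fset (subst_mat x (Var y) M). \<forall>A\<in>fset G. ok_args {} (map ?r xs) A"
    using xs(3) universal.hyps by (auto simp: subst_mat_def free_for_mat_def intro!: ok_args_subst_free)
  moreover have "funs_mat (subst_mat x (Var y) M) \<subseteq> fset F"
    using F by (auto simp: funs_mat_def subst_mat_def funs_subst_fm_var)
  ultimately show ?case unfolding standard_expr_iff by blast
next
  case (functional i n F j M X)
  from functional.prems obtain xs where xs: "distinct xs" "set xs = fset X"
    "\<And>G A. G |\<in>| M \<Longrightarrow> A |\<in>| G \<Longrightarrow> ok_args {} xs A" and F: "funs_mat M \<subseteq> fset (finsert (i, n) F)"
    unfolding standard_expr_iff by blast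
  have "funs_mat (ren_mat i j n M) \<subseteq> fset (finsert (j, n) F)"
    using F by (auto simp: funs_mat_def ren_mat_def funs_ren_fm)
  moreover have "\<forall>G\<in>fset (ren_mat i j n M). \<forall>A\<in>fset G. ok_args {} xs A"
    using xs(3) by (auto simp: ren_mat_def intro: ok_args_ren)
  ultimately show ?case using xs unfolding standard_expr_iff by blast
qed

lemma standard_expr_cong: "equivclp rename d e \<Longrightarrow> standard_expr d \<longleftrightarrow> standard_expr e"
  by (rule rename_cong[OF standard_expr_rename])


lift_definition satisfiable :: "'u itself \<Rightarrow> datum \<Rightarrow> bool" is satisfiable_expr
  by (rule satisfiable_expr_cong)

lift_definition standard :: "datum \<Rightarrow> bool" is standard_expr
  by (rule standard_expr_cong)

end

theory Submission
  imports Defs "HOL-Library.Countable"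
begin

text \<open>
  Synthetic G-rules collapse the matrix to a single formula and then turn the prefix, innermost
  variable first, into quantifiers of that formula; standardness ensures that, at each stage, every
  functional term of largest possible arity is a function applied to the whole remaining universal
  prefix, so that it can be abstracted to an existential quantifier. Since
  components are sets, a universal formula can afterwards be instantiated without being lost, and
  EM provides cut. Keeping the universal prefix empty, witnesses are nullary functions, and a
  Henkin construction yields a term model of every component that cannot be deleted by a deduction.
\<close>

section \<open>Bound variables\<close>

text \<open>The order of elimination is forced. Once a universal variable \<open>x\<close> is
  quantified inside the formula, a functional term with \<open>x\<close> among its arguments can no
  longer be abstracted by the synthetic \<open>Exists\<close> rule, because \<open>x\<close> would
  be captured. So all functions depending on \<open>x\<close> must go first; if \<open>x\<close> is
  last in the ordering, these are exactly the functions of full arity, and each of them occurs with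
  one argument list only. Every elimination step carries a semantic claim from the new datum back to
  the old one (a Skolem function is chosen as interpretation), so unsatisfiability moves forward
  with the deduction. In the second half the obstacle is that components are not independent:
  \<open>Inst\<close> acts on the whole matrix and the quantifier rules have provisos about the
  other components. Refutability of a component is therefore defined as deletability in every
  context, and each quantifier step removes the variable or constant that it brought into the
  prefix. The infinite type enters only at the end, as a place for an injective copy of the
  countable set of terms.\<close>

primrec bv_fm :: "fm \<Rightarrow> var set" where
  "bv_fm (Pred p ts) = {}"
| "bv_fm (Neg A) = bv_fm A"
| "bv_fm (Conj A B) = bv_fm A \<union> bv_fm B"
| "bv_fm (Disj A B) = bv_fm A \<union> bv_fm B"
| "bv_fm (Forall x A) = insert x (bv_fm A)"
| "bv_fm (Exists x A) = insert x (bv_fm A)"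

text \<open>Terms are ignored, so an instance or a variant of the body of a quantified formula has
  smaller rank than the formula.\<close>

primrec rank :: "fm \<Rightarrow> nat" where
  "rank (Pred p ts) = 0"
| "rank (Neg A) = Suc (rank A)"
| "rank (Conj A B) = Suc (rank A + rank B)"
| "rank (Disj A B) = Suc (rank A + rank B)"
| "rank (Forall x A) = Suc (rank A)"
| "rank (Exists x A) = Suc (rank A)"

lemma finite_fv_tm [simp]: "finite (fv_tm t)"
  by (induction t) auto

lemma finite_fv_fm [simp]: "finite (fv_fm A)"
  by (induction A) auto

lemma finite_bv_fm [simp]: "finite (bv_fm A)"
  by (induction A) auto

lemma finite_funs_tm [simp]: "finite (funs_tm t)"
  by (induction t) auto

lemma finite_funs_fm [simp]: "finite (funs_fm A)"
  by (induction A) auto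

lemma rank_subst_fm [simp]: "rank (subst_fm x t A) = rank A"
  by (induction A) auto

lemma bv_subst_fm [simp]: "bv_fm (subst_fm x t A) = bv_fm A"
  by (induction A) auto

lemma rename_fm_rank: "rename_fm A B \<Longrightarrow> rank B = rank A"
  by (induction rule: rename_fm.induct) auto

lemma free_for_bv: "fv_tm t \<inter> bv_fm A = {} \<Longrightarrow> free_for t x A"
  by (induction A) auto

lemma free_for_const [simp]: "free_for (Fn g []) x A"
  by (rule free_for_bv) simp

lemma free_for_fresh: "x \<notin> fv_fm A \<Longrightarrow> free_for t x A"
  by (induction A) auto

lemma subst_tm_comp: "y \<notin> fv_tm s \<Longrightarrow> subst_tm y t (subst_tm x (Var y) s) = subst_tm x t s"
  by (induction s) auto

text \<open>A quantified variable is renamed to a fresh \<open>y\<close> before it enters the prefix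
  and is instantiated there. This lemma and \<open>free_for_subst\<close> erase the detour.\<close>

lemma subst_fm_comp:
  "\<lbrakk>y \<notin> fv_fm A; y \<notin> bv_fm A\<rbrakk> \<Longrightarrow> subst_fm y t (subst_fm x (Var y) A) = subst_fm x t A"
  by (induction A) (auto simp: subst_tm_comp subst_fm_fresh)

lemma free_for_subst:
  "\<lbrakk>y \<notin> fv_fm A; y \<notin> bv_fm A; free_for t x A\<rbrakk> \<Longrightarrow> free_for t y (subst_fm x (Var y) A)"
proof (induction A)
  case (Forall z A)
  show ?case
  proof (cases "x \<in> fv_fm (Forall z A)")
    case False
    then show ?thesis
      using Forall.prems subst_fm_fresh[OF False] by (auto simp del: subst_fm.simps intro!: free_for_fresh)
  qed (use Forall in auto)
next
  case (Exists z A)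
  show ?case
  proof (cases "x \<in> fv_fm (Exists z A)")
    case False
    then show ?thesis
      using Exists.prems subst_fm_fresh[OF False] by (auto simp del: subst_fm.simps intro!: free_for_fresh)
  qed (use Exists in auto)
qed auto

section \<open>Variants whose bound variables avoid a given finite set\<close>

lemma rtranclp_mono_fun:
  assumes "r\<^sup>*\<^sup>* a b" and "\<And>a b. r a b \<Longrightarrow> s (f a) (f b)"
  shows "s\<^sup>*\<^sup>* (f a) (f b)"
  using assms(1)
proof induction
  case (step b c)
  then show ?case using assms(2) by (meson rtranclp.rtrancl_into_rtrancl)
qed simp

lemma obtain_fresh_var:
  fixes V :: "var set"
  assumes "finite V"
  obtains y where "y \<notin> V"
  using ex_new_if_finite[OF infinite_UNIV_nat assms] by blast

text \<open>The body is renamed before its quantifier, so the new bound variable can be chosen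
  outside the variables of the finished body, which excludes capture.\<close>

lemma ex_variant:
  assumes "finite V"
  shows "\<exists>A'. rename_fm\<^sup>*\<^sup>* A A' \<and> bv_fm A' \<inter> V = {}"
proof (induction A)
  case (Pred p ts)
  show ?case by (intro exI[of _ "Pred p ts"]) simp
next
  case (Neg A)
  then obtain A' where "rename_fm\<^sup>*\<^sup>* A A'" "bv_fm A' \<inter> V = {}" by blast
  then show ?case
    using rtranclp_mono_fun[of rename_fm A A' rename_fm Neg, OF _ in_Neg]
    by (intro exI[of _ "Neg A'"]) auto
next
  case (Conj A B)
  then obtain A' B' where *: "rename_fm\<^sup>*\<^sup>* A A'" "bv_fm A' \<inter> V = {}"
    "rename_fm\<^sup>*\<^sup>* B B'" "bv_fm B' \<inter> V = {}" by blast
  have "rename_fm\<^sup>*\<^sup>* (Conj A B) (Conj A' B)"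
    using rtranclp_mono_fun[of rename_fm A A' rename_fm "\<lambda>A. Conj A B", OF *(1) in_Conj1] .
  also have "rename_fm\<^sup>*\<^sup>* (Conj A' B) (Conj A' B')"
    using rtranclp_mono_fun[of rename_fm B B' rename_fm "Conj A'", OF *(3) in_Conj2] .
  finally show ?case using * by (intro exI[of _ "Conj A' B'"]) auto
next
  case (Disj A B)
  then obtain A' B' where *: "rename_fm\<^sup>*\<^sup>* A A'" "bv_fm A' \<inter> V = {}"
    "rename_fm\<^sup>*\<^sup>* B B'" "bv_fm B' \<inter> V = {}" by blast
  have "rename_fm\<^sup>*\<^sup>* (Disj A B) (Disj A' B)"
    using rtranclp_mono_fun[of rename_fm A A' rename_fm "\<lambda>A. Disj A B", OF *(1) in_Disj1] .
  also have "rename_fm\<^sup>*\<^sup>* (Disj A' B) (Disj A' B')"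
    using rtranclp_mono_fun[of rename_fm B B' rename_fm "Disj A'", OF *(3) in_Disj2] .
  finally show ?case using * by (intro exI[of _ "Disj A' B'"]) auto
next
  case (Forall x A)
  then obtain A' where *: "rename_fm\<^sup>*\<^sup>* A A'" "bv_fm A' \<inter> V = {}" by blast
  obtain y where y: "y \<notin> V \<union> fv_fm A' \<union> bv_fm A'"
    by (rule obtain_fresh_var[of "V \<union> fv_fm A' \<union> bv_fm A'"]) (use assms in auto)
  have "rename_fm\<^sup>*\<^sup>* (Forall x A) (Forall x A')"
    using rtranclp_mono_fun[of rename_fm A A' rename_fm "Forall x", OF *(1) in_Forall] .
  also have "rename_fm (Forall x A') (Forall y (subst_fm x (Var y) A'))"
    using y by (intro rename_fm.Forall free_for_bv) auto
  finally show ?case using * y by (intro exI[of _ "Forall y (subst_fm x (Var y) A')"]) auto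
next
  case (Exists x A)
  then obtain A' where *: "rename_fm\<^sup>*\<^sup>* A A'" "bv_fm A' \<inter> V = {}" by blast
  obtain y where y: "y \<notin> V \<union> fv_fm A' \<union> bv_fm A'"
    by (rule obtain_fresh_var[of "V \<union> fv_fm A' \<union> bv_fm A'"]) (use assms in auto)
  have "rename_fm\<^sup>*\<^sup>* (Exists x A) (Exists x A')"
    using rtranclp_mono_fun[of rename_fm A A' rename_fm "Exists x", OF *(1) in_Exists] .
  also have "rename_fm (Exists x A') (Exists y (subst_fm x (Var y) A'))"
    using y by (intro rename_fm.Exists free_for_bv) auto
  finally show ?case using * y by (intro exI[of _ "Exists y (subst_fm x (Var y) A')"]) auto
qed

lemma rename_fm_rtranclp_invariant:
  assumes "rename_fm\<^sup>*\<^sup>* A B" and "\<And>A B. rename_fm A B \<Longrightarrow> f B = f A"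
  shows "f B = f A"
  using assms by (induction rule: rtranclp_induct) auto


section \<open>Deductions\<close>

lemma inferableI:
  "G_rule (Dat F X M) (Dat F' X' M') \<Longrightarrow> inferable (Datum F X M) (Datum F' X' M')"
  "N_rule (Dat F X M) (Dat F' X' M') \<Longrightarrow> inferable (Datum F X M) (Datum F' X' M')"
  "S_rule (Dat F X M) (Dat F' X' M') \<Longrightarrow> inferable (Datum F X M) (Datum F' X' M')"
  unfolding inferable_def by blast+

lemma inferable_analytic:
  "analytic (Dat F X M) (Dat F' X' M') \<Longrightarrow> inferable (Datum F X M) (Datum F' X' M')"
  by (rule inferableI(1)) (rule G_rule.analytic)

lemma inferable_synthetic:
  "analytic (Dat F' X' M') (Dat F X M) \<Longrightarrow> inferable (Datum F X M) (Datum F' X' M')"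
  by (rule inferableI(1)) (rule G_rule.synthetic)

lemma QDC_refutable_iff: "QDC_refutable d \<longleftrightarrow> inferable\<^sup>*\<^sup>* d bottom"
proof
  assume "QDC_refutable d"
  then obtain ds where "ds \<noteq> []" "hd ds = d" "last ds = bottom" "successively inferable ds"
    unfolding QDC_refutable_def QDC_deduction_def by blast
  then show "inferable\<^sup>*\<^sup>* d bottom"
  proof (induction ds arbitrary: d)
    case (Cons a ds)
    then show ?case
      by (cases ds) (auto intro: converse_rtranclp_into_rtranclp)
  qed simp
next
  assume "inferable\<^sup>*\<^sup>* d bottom"
  then show "QDC_refutable d"
  proof (induction rule: converse_rtranclp_induct)
    case base
    show ?case unfolding QDC_refutable_def QDC_deduction_def by (intro exI[of _ "[bottom]"]) simp
  next
    case (step d e)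
    then obtain ds where ds: "ds \<noteq> []" "hd ds = e" "last ds = bottom" "successively inferable ds"
      unfolding QDC_refutable_def QDC_deduction_def by blast
    with step(1) show ?case unfolding QDC_refutable_def QDC_deduction_def
      by (intro exI[of _ "d # ds"]) (auto simp: successively_Cons)
  qed
qed

text \<open>A chain of renamings becomes an equality of data and so costs no deduction step.\<close>

lemma Datum_rename_fm:
  assumes "rename_fm\<^sup>*\<^sup>* A A'"
  shows "Datum F X (finsert (finsert A G) R) = Datum F X (finsert (finsert A' G) R)"
  using assms
proof induction
  case (step B C)
  have "equivclp rename (Dat F X (finsert (finsert B G) R)) (Dat F X (finsert (finsert C G) R))"
    using rename.quantified[OF step(2)] by blast
  with step show ?case by (auto simp: Datum.abs_eq datum.abs_eq_iff intro: equivclp_trans)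
qed simp

lemma deduce_no_universal: "inferable\<^sup>*\<^sup>* (Datum F X {||}) (Datum F {||} {||})"
proof (induction X)
  case (insert x X)
  \<comment> \<open>The matrix is empty, so \<open>Inst\<close> may use an arbitrary term.\<close>
  have "inferable (Datum F (finsert x X) {||}) (Datum F X {||})"
    using S_rule.Inst[of "Var 0" x "{||}" F X]
    by (intro inferableI(3)) (simp add: free_for_mat_def subst_mat_def)
  with insert show ?case by (meson converse_rtranclp_into_rtranclp)
qed simp

lemma deduce_no_functional: "inferable\<^sup>*\<^sup>* (Datum F X {||}) (Datum {||} X {||})"
proof (induction F)
  case (insert g F)
  have "inferable (Datum (finsert g F) X {||}) (Datum F X {||})"
    by (intro inferableI(3) S_rule.EVE) (simp add: funs_mat_def)
  with insert show ?case by (meson converse_rtranclp_into_rtranclp)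
qed simp

lemma deduce_bottom: "inferable\<^sup>*\<^sup>* (Datum F X {||}) bottom"
  unfolding bottom_def using deduce_no_universal deduce_no_functional by (rule rtranclp_trans)


section \<open>Refutable components\<close>

text \<open>\<open>F\<close> and \<open>R\<close> are arbitrary and come back unchanged, so
  refutations can be run one after another in any context. The universal prefix is empty at both
  ends; in between, the quantifier lemmas below use only a variable that is fresh for
  \<open>R\<close>.\<close>

definition refut :: "fm fset \<Rightarrow> bool" where
  "refut G \<longleftrightarrow> (\<forall>F R. inferable\<^sup>*\<^sup>* (Datum F {||} (finsert G R)) (Datum F {||} R))"

lemma refutI:
  "(\<And>F R. inferable\<^sup>*\<^sup>* (Datum F {||} (finsert G R)) (Datum F {||} R)) \<Longrightarrow> refut G"
  by (simp add: refut_def)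

lemma refutD: "refut G \<Longrightarrow> inferable\<^sup>*\<^sup>* (Datum F {||} (finsert G R)) (Datum F {||} R)"
  by (simp add: refut_def)

lemma refut_one:
  assumes "\<And>F R. inferable (Datum F {||} (finsert G R)) (Datum F {||} (finsert H R))" and "refut H"
  shows "refut G"
  by (rule refutI) (meson assms converse_rtranclp_into_rtranclp refutD)

text \<open>\<open>K\<close> waits as part of the context while \<open>H\<close> is deleted, which
  is why \<open>refut\<close> quantifies over \<open>R\<close>.\<close>

lemma refut_two:
  assumes "\<And>F R. inferable (Datum F {||} (finsert G R)) (Datum F {||} (finsert H (finsert K R)))"
    and "refut H" "refut K"
  shows "refut G"
proof (rule refutI)
  fix F R
  have "inferable (Datum F {||} (finsert G R)) (Datum F {||} (finsert H (finsert K R)))"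
    by (rule assms(1))
  also have "inferable\<^sup>*\<^sup>* (Datum F {||} (finsert H (finsert K R))) (Datum F {||} (finsert K R))"
    using assms(2) by (rule refutD)
  also have "inferable\<^sup>*\<^sup>* (Datum F {||} (finsert K R)) (Datum F {||} R)"
    using assms(3) by (rule refutD)
  finally show "inferable\<^sup>*\<^sup>* (Datum F {||} (finsert G R)) (Datum F {||} R)" .
qed

lemma refut_mono:
  assumes "refut G" "G |\<subseteq>| H"
  shows "refut H"
proof (rule refut_one[OF _ assms(1)])
  fix F R
  have "H = G |\<union>| H" using assms(2) by auto
  then show "inferable (Datum F {||} (finsert H R)) (Datum F {||} (finsert G R))"
    using S_rule.Del[of F "{||}" G H R] by (intro inferableI(3)) simp
qed

lemma refut_NC: "refut (finsert A (finsert (Neg A) G))"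
  by (rule refutI) (intro r_into_rtranclp inferableI(2) N_rule.NC)

lemma refut_cut: "refut (finsert A G) \<Longrightarrow> refut (finsert (Neg A) G) \<Longrightarrow> refut G"
  by (rule refut_two[OF inferableI(2)[OF N_rule.EM]])

lemma refut_Conj: "refut (finsert A (finsert B G)) \<Longrightarrow> refut (finsert (Conj A B) G)"
  by (rule refut_one[OF inferable_analytic[OF analytic.Conj]])

lemma refut_Neg_Disj:
  "refut (finsert (Neg A) (finsert (Neg B) G)) \<Longrightarrow> refut (finsert (Neg (Disj A B)) G)"
  by (rule refut_one[OF inferable_analytic[OF analytic.Neg_Disj]])

lemma refut_Disj:
  "refut (finsert A G) \<Longrightarrow> refut (finsert B G) \<Longrightarrow> refut (finsert (Disj A B) G)"
  by (rule refut_two[OF inferable_analytic[OF analytic.Disj]])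

lemma refut_Neg_Conj:
  "refut (finsert (Neg A) G) \<Longrightarrow> refut (finsert (Neg B) G) \<Longrightarrow> refut (finsert (Neg (Conj A B)) G)"
  by (rule refut_two[OF inferable_analytic[OF analytic.Neg_Conj]])

lemma finite_fv_set [simp]: "finite (fv_set G)" and finite_fv_mat [simp]: "finite (fv_mat R)"
  by (auto simp: fv_set_def fv_mat_def)

lemma finite_funs_mat [simp]: "finite (funs_mat R)"
  by (auto simp: funs_mat_def)

lemma subst_fm_image_fresh: "x \<notin> fv_set G \<Longrightarrow> subst_fm x t |`| G = G"
proof -
  assume "x \<notin> fv_set G"
  then have "subst_fm x t A = A" if "A |\<in>| G" for A
    using that by (intro subst_fm_fresh) (auto simp: fv_set_def)
  then show ?thesis by (metis fset.map_cong fset.map_ident)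
qed

lemma subst_mat_fresh: "x \<notin> fv_mat R \<Longrightarrow> subst_mat x t R = R"
proof -
  assume "x \<notin> fv_mat R"
  then have "subst_fm x t |`| G = G" if "G |\<in>| R" for G
    using that by (intro subst_fm_image_fresh) (auto simp: fv_mat_def)
  then show ?thesis unfolding subst_mat_def by (metis fset.map_cong fset.map_ident)
qed

lemma free_for_mat_fresh: "x \<notin> fv_mat R \<Longrightarrow> free_for_mat t x R"
  by (auto simp: free_for_mat_def fv_mat_def fv_set_def intro: free_for_fresh)

text \<open>\<open>Inst\<close> substitutes throughout the matrix; freshness of \<open>y\<close> for
  \<open>G\<close> and \<open>R\<close> confines its effect to \<open>A\<close>.\<close>

lemma inferable_Inst_component:
  assumes "y \<notin> fv_mat (finsert G R)" "free_for t y A"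
  shows "inferable (Datum F {|y|} (finsert (finsert A G) R))
    (Datum F {||} (finsert (finsert (subst_fm y t A) G) R))"
proof -
  have G: "y \<notin> fv_set G" and R: "y \<notin> fv_mat R"
    using assms(1) by (auto simp: fv_mat_def)
  have "subst_mat y t (finsert (finsert A G) R) = finsert (finsert (subst_fm y t A) G) R"
    using subst_fm_image_fresh[OF G] subst_mat_fresh[OF R] by (simp add: subst_mat_def)
  moreover have "free_for_mat t y (finsert (finsert A G) R)"
    using free_for_mat_fresh[OF assms(1)] assms(2) by (auto simp: free_for_mat_def)
  ultimately show ?thesis
    using S_rule.Inst[of t y "finsert (finsert A G) R" F "{||}"] by (intro inferableI(3)) simp
qed

text \<open>\<open>A'\<close> is a variant of the body in which \<open>t\<close> is not captured.
  With its variable renamed to a fresh \<open>y\<close>, the formula meets the proviso of the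
  \<open>Forall\<close> rule; \<open>y\<close> enters the empty prefix and leaves it at once by
  \<open>Inst\<close>.\<close>

lemma refut_Forall:
  assumes ren: "rename_fm\<^sup>*\<^sup>* A A'" and ff: "free_for t x A'"
    and ref: "refut (finsert (subst_fm x t A') G)"
  shows "refut (finsert (Forall x A) G)"
proof (rule refutI)
  fix F R
  let ?V = "fv_fm A' \<union> bv_fm A' \<union> fv_mat (finsert G R)"
  obtain y where y: "y \<notin> ?V" by (rule obtain_fresh_var[of ?V]) auto
  let ?B = "subst_fm x (Var y) A'"
  have "rename_fm\<^sup>*\<^sup>* (Forall x A) (Forall x A')"
    using rtranclp_mono_fun[of rename_fm A A' rename_fm "Forall x", OF ren in_Forall] .
  also have "rename_fm (Forall x A') (Forall y ?B)"
    using y by (intro rename_fm.Forall free_for_bv) auto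
  finally have "Datum F {||} (finsert (finsert (Forall x A) G) R) =
      Datum F {||} (finsert (finsert (Forall y ?B) G) R)"
    by (rule Datum_rename_fm)
  also have "inferable \<dots> (Datum F {|y|} (finsert (finsert ?B G) R))"
    using y by (intro inferable_analytic analytic.Forall) (auto simp: fv_mat_def)
  also have "inferable\<^sup>*\<^sup>* \<dots> (Datum F {||} (finsert (finsert (subst_fm y t ?B) G) R))"
    using y ff by (intro r_into_rtranclp inferable_Inst_component free_for_subst) auto
  also have "subst_fm y t ?B = subst_fm x t A'"
    using y by (intro subst_fm_comp) auto
  also have "inferable\<^sup>*\<^sup>* (Datum F {||} (finsert (finsert (subst_fm x t A') G) R)) (Datum F {||} R)"
    using ref by (rule refutD)
  finally show "inferable\<^sup>*\<^sup>* (Datum F {||} (finsert (finsert (Forall x A) G) R)) (Datum F {||} R)" .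
qed

lemma refut_Neg_Exists:
  assumes ren: "rename_fm\<^sup>*\<^sup>* A A'" and ff: "free_for t x A'"
    and ref: "refut (finsert (Neg (subst_fm x t A')) G)"
  shows "refut (finsert (Neg (Exists x A)) G)"
proof (rule refutI)
  fix F R
  let ?V = "fv_fm A' \<union> bv_fm A' \<union> fv_mat (finsert G R)"
  obtain y where y: "y \<notin> ?V" by (rule obtain_fresh_var[of ?V]) auto
  let ?B = "subst_fm x (Var y) A'"
  have "rename_fm\<^sup>*\<^sup>* (Neg (Exists x A)) (Neg (Exists x A'))"
    using rtranclp_mono_fun[of rename_fm A A' rename_fm "\<lambda>A. Neg (Exists x A)", OF ren in_Neg[OF in_Exists]] .
  also have "rename_fm (Neg (Exists x A')) (Neg (Exists y ?B))"
    using y by (intro in_Neg rename_fm.Exists free_for_bv) auto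
  finally have "Datum F {||} (finsert (finsert (Neg (Exists x A)) G) R) =
      Datum F {||} (finsert (finsert (Neg (Exists y ?B)) G) R)"
    by (rule Datum_rename_fm)
  also have "inferable \<dots> (Datum F {|y|} (finsert (finsert (Neg ?B) G) R))"
    using y by (intro inferable_analytic analytic.Neg_Exists) (auto simp: fv_mat_def)
  also have "inferable\<^sup>*\<^sup>* \<dots> (Datum F {||} (finsert (finsert (subst_fm y t (Neg ?B)) G) R))"
    using y free_for_subst[OF _ _ ff, of y] by (intro r_into_rtranclp inferable_Inst_component) auto
  also have "subst_fm y t (Neg ?B) = Neg (subst_fm x t A')"
    using y subst_fm_comp by auto
  also have "inferable\<^sup>*\<^sup>* (Datum F {||} (finsert (finsert (Neg (subst_fm x t A')) G) R)) (Datum F {||} R)"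
    using ref by (rule refutD)
  finally show "inferable\<^sup>*\<^sup>* (Datum F {||} (finsert (finsert (Neg (Exists x A)) G) R)) (Datum F {||} R)" .
qed

lemma obtain_fresh_const:
  assumes "finite V"
  obtains g :: nat where "(g, 0 :: nat) \<notin> V"
proof -
  have "finite (fst ` V)" using assms by simp
  then obtain g where "g \<notin> fst ` V" using ex_new_if_finite[OF infinite_UNIV_nat] by blast
  then have "(g, 0) \<notin> V" by force
  then show thesis by (rule that)
qed

text \<open>
  The constant has to be fresh for the other components as well, so the premise ranges over
  all constants that are fresh for the component at hand.
\<close>

lemma refut_Exists:
  assumes "\<And>g. (g, 0) \<notin> funs_mat {|finsert A G|} \<Longrightarrow> refut (finsert (subst_fm x (Fn g []) A) G)"
  shows "refut (finsert (Exists x A) G)"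
proof (rule refutI)
  fix F R
  let ?V = "fset F \<union> funs_mat (finsert (finsert A G) R)"
  obtain g where g: "(g, 0) \<notin> ?V" by (rule obtain_fresh_const[of ?V]) auto
  have "inferable (Datum F {||} (finsert (finsert (Exists x A) G) R))
      (Datum (finsert (g, 0) F) {||} (finsert (finsert (subst_fm x (Fn g []) A) G) R))"
    using analytic.Exists[of "[]" "{||}" g A G R x F] g by (intro inferable_analytic) auto
  also have "inferable\<^sup>*\<^sup>* \<dots> (Datum (finsert (g, 0) F) {||} R)"
    using g by (intro refutD assms) (auto simp: funs_mat_def)
  \<comment> \<open>The component containing \<open>g\<close> is gone and \<open>g\<close> is fresh
    for \<open>R\<close>, so \<open>EVE\<close> restores the prefix.\<close>
  also have "inferable \<dots> (Datum F {||} R)"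
    using g by (intro inferableI(3) S_rule.EVE) (auto simp: funs_mat_def)
  finally show "inferable\<^sup>*\<^sup>* (Datum F {||} (finsert (finsert (Exists x A) G) R)) (Datum F {||} R)" .
qed

lemma refut_Neg_Forall:
  assumes "\<And>g. (g, 0) \<notin> funs_mat {|finsert A G|} \<Longrightarrow> refut (finsert (Neg (subst_fm x (Fn g []) A)) G)"
  shows "refut (finsert (Neg (Forall x A)) G)"
proof (rule refutI)
  fix F R
  let ?V = "fset F \<union> funs_mat (finsert (finsert A G) R)"
  obtain g where g: "(g, 0) \<notin> ?V" by (rule obtain_fresh_const[of ?V]) auto
  have "inferable (Datum F {||} (finsert (finsert (Neg (Forall x A)) G) R))
      (Datum (finsert (g, 0) F) {||} (finsert (finsert (Neg (subst_fm x (Fn g []) A)) G) R))"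
    using analytic.Neg_Forall[of "[]" "{||}" g A G R x F] g by (intro inferable_analytic) auto
  also have "inferable\<^sup>*\<^sup>* \<dots> (Datum (finsert (g, 0) F) {||} R)"
    using g by (intro refutD assms) (auto simp: funs_mat_def)
  also have "inferable \<dots> (Datum F {||} R)"
    using g by (intro inferableI(3) S_rule.EVE) (auto simp: funs_mat_def)
  finally show "inferable\<^sup>*\<^sup>* (Datum F {||} (finsert (finsert (Neg (Forall x A)) G) R)) (Datum F {||} R)" .
qed


section \<open>Maximal irrefutable sets\<close>

instance tm :: countable by countable_datatype

instance fm :: countable by countable_datatype

text \<open>Irrefutability is asked of finite subsets, since components are finite. Freshness of the
  witnesses is not recorded: it has done its work in \<open>refut_Exists\<close> and
  \<open>refut_Neg_Forall\<close>.\<close>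

definition saturated :: "fm set \<Rightarrow> bool" where
  "saturated S \<longleftrightarrow> (\<forall>G. fset G \<subseteq> S \<longrightarrow> \<not> refut G) \<and> (\<forall>A. A \<in> S \<or> Neg A \<in> S) \<and>
    (\<forall>x A. Exists x A \<in> S \<longrightarrow> (\<exists>g. subst_fm x (Fn g []) A \<in> S)) \<and>
    (\<forall>x A. Neg (Forall x A) \<in> S \<longrightarrow> (\<exists>g. Neg (subst_fm x (Fn g []) A) \<in> S))"

text \<open>One Henkin step. Witnesses come from the contrapositives of \<open>refut_Exists\<close>
  and \<open>refut_Neg_Forall\<close>; a finite set leaves infinitely many constants fresh, so no
  reserve of new symbols is set aside.\<close>

lemma extend_irrefutable:
  assumes "\<not> refut G"
  shows "\<exists>H. G |\<subseteq>| H \<and> \<not> refut H \<and> (A |\<in>| H \<or> refut (finsert A G)) \<and>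
    (\<forall>x B. A = Exists x B \<longrightarrow> A |\<in>| H \<longrightarrow> (\<exists>g. subst_fm x (Fn g []) B |\<in>| H)) \<and>
    (\<forall>x B. A = Neg (Forall x B) \<longrightarrow> A |\<in>| H \<longrightarrow> (\<exists>g. Neg (subst_fm x (Fn g []) B) |\<in>| H))"
proof (cases "refut (finsert A G)")
  case True
  \<comment> \<open>Hence with \<open>G\<close> itself as \<open>H\<close> both witness clauses hold
    vacuously.\<close>
  then have "A |\<notin>| G" using assms by (metis finsert_absorb)
  with True assms show ?thesis by (intro exI[of _ G]) auto
next
  case False
  let ?G = "finsert A G"
  consider x B where "A = Exists x B" | x B where "A = Neg (Forall x B)"
    | "\<forall>x B. A \<noteq> Exists x B \<and> A \<noteq> Neg (Forall x B)" by blast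
  then show ?thesis
  proof cases
    case 1
    \<comment> \<open>The rest of the component is taken to be \<open>?G\<close>, which already
      contains \<open>A\<close>: inserting \<open>Exists x B\<close> changes nothing, and the
      formula stays beside its witness.\<close>
    obtain g where "\<not> refut (finsert (subst_fm x (Fn g []) B) ?G)"
      using refut_Exists[of B ?G x] False 1 by auto
    with 1 show ?thesis by (intro exI[of _ "finsert (subst_fm x (Fn g []) B) ?G"]) auto
  next
    case 2
    obtain g where "\<not> refut (finsert (Neg (subst_fm x (Fn g []) B)) ?G)"
      using refut_Neg_Forall[of B ?G x] False 2 by auto
    with 2 show ?thesis by (intro exI[of _ "finsert (Neg (subst_fm x (Fn g []) B)) ?G"]) auto
  next
    case 3
    with False show ?thesis by (intro exI[of _ ?G]) auto
  qed
qed

lemma ex_saturated: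
  assumes "\<not> refut G"
  shows "\<exists>S. saturated S \<and> fset G \<subseteq> S"
proof -
  define Q where "Q n K H \<longleftrightarrow> K |\<subseteq>| H \<and> (from_nat n |\<in>| H \<or> refut (finsert (from_nat n) K)) \<and>
    (\<forall>x B. from_nat n = Exists x B \<longrightarrow> from_nat n |\<in>| H \<longrightarrow> (\<exists>g. subst_fm x (Fn g []) B |\<in>| H)) \<and>
    (\<forall>x B. from_nat n = Neg (Forall x B) \<longrightarrow> from_nat n |\<in>| H \<longrightarrow>
      (\<exists>g. Neg (subst_fm x (Fn g []) B) |\<in>| H))" for n K H
  have "\<exists>f. \<forall>n. (\<not> refut (f n) \<and> G |\<subseteq>| f n) \<and> Q n (f n) (f (Suc n))"
  proof (rule dependent_nat_choice)
    fix K n assume K: "\<not> refut K \<and> G |\<subseteq>| K"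
    then show "\<exists>H. (\<not> refut H \<and> G |\<subseteq>| H) \<and> Q n K H"
      using extend_irrefutable[of K "from_nat n"] unfolding Q_def by (meson order_trans)
  qed (use assms in auto)
  then obtain f where irr: "\<And>n. \<not> refut (f n)" and G: "\<And>n. G |\<subseteq>| f n"
    and Q: "\<And>n. Q n (f n) (f (Suc n))" by blast
  have "f n |\<subseteq>| f (Suc n)" for n
    using Q[of n] unfolding Q_def by (rule conjunct1)
  then have mono: "f m |\<subseteq>| f n" if "m \<le> n" for m n
    using that by (rule lift_Suc_mono_le[of f])
  define S where "S = (\<Union>n. fset (f n))"
  have stage: "\<exists>n. K |\<subseteq>| f n" if "fset K \<subseteq> S" for K
    using that
  proof (induction K)
    case (insert A K)
    then obtain m n where "K |\<subseteq>| f m" "A |\<in>| f n" by (auto simp: S_def)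
    then have "finsert A K |\<subseteq>| f (max m n)" using mono[of m "max m n"] mono[of n "max m n"] by auto
    then show ?case by blast
  qed simp
  have cons: "\<not> refut K" if "fset K \<subseteq> S" for K
    using stage[OF that] irr refut_mono by blast
  have added: "A |\<in>| f (Suc (to_nat A)) \<or> refut (finsert A (f (to_nat A)))" for A
    using Q[of "to_nat A", unfolded Q_def from_nat_to_nat] by blast
  \<comment> \<open>Membership is settled at the stage numbered by the formula itself, however it
    got in: if \<open>A\<close> is in \<open>S\<close>, then \<open>A\<close> and its stage form a
    finite subset of \<open>S\<close>, hence an irrefutable one. The witness clauses of
    \<open>Q\<close> speak of this stage only.\<close>
  have mem: "A \<in> S \<longleftrightarrow> A |\<in>| f (Suc (to_nat A))" for A
  proof
    assume A: "A \<in> S"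
    have "\<not> refut (finsert A (f (to_nat A)))"
      using A by (intro cons) (auto simp: S_def)
    then show "A |\<in>| f (Suc (to_nat A))" using added by blast
  qed (auto simp: S_def)
  have out: "refut (finsert A (f (to_nat A)))" if "A \<notin> S" for A
    using that added unfolding mem by blast
  have "A \<in> S \<or> Neg A \<in> S" for A
  proof (rule ccontr)
    assume "\<not> ?thesis"
    then have A: "refut (finsert A (f (to_nat A)))" "refut (finsert (Neg A) (f (to_nat (Neg A))))"
      using out by auto
    let ?n = "max (to_nat A) (to_nat (Neg A))"
    have "refut (finsert A (f ?n))"
      using A(1) by (rule refut_mono) (use mono[of "to_nat A" ?n] in auto)
    moreover have "refut (finsert (Neg A) (f ?n))"
      using A(2) by (rule refut_mono) (use mono[of "to_nat (Neg A)" ?n] in auto)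
    ultimately show False using irr refut_cut by blast
  qed
  moreover have "\<exists>g. subst_fm x (Fn g []) A \<in> S" if "Exists x A \<in> S" for x A
  proof -
    have "\<exists>g. subst_fm x (Fn g []) A |\<in>| f (Suc (to_nat (Exists x A)))"
      using Q[of "to_nat (Exists x A)", unfolded Q_def from_nat_to_nat] that[unfolded mem] by simp
    then show ?thesis by (auto simp: S_def)
  qed
  moreover have "\<exists>g. Neg (subst_fm x (Fn g []) A) \<in> S" if "Neg (Forall x A) \<in> S" for x A
  proof -
    have "\<exists>g. Neg (subst_fm x (Fn g []) A) |\<in>| f (Suc (to_nat (Neg (Forall x A))))"
      using Q[of "to_nat (Neg (Forall x A))", unfolded Q_def from_nat_to_nat] that[unfolded mem] by simp
    then show ?thesis by (auto simp: S_def)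
  qed
  moreover have "fset G \<subseteq> S" using G[of 0] by (auto simp: S_def)
  ultimately show ?thesis unfolding saturated_def using cons by blast
qed

section \<open>The term model of a saturated set\<close>

text \<open>The elements are the codes \<open>e t\<close> of all terms, open ones included, so that
  variables denote themselves; \<open>e\<close> transports the terms into the prescribed
  type.\<close>

locale term_model =
  fixes S :: "fm set" and e :: "tm \<Rightarrow> 'u"
  assumes S: "saturated S" and e: "inj e"
begin

definition I :: "nat \<Rightarrow> 'u list \<Rightarrow> 'u" where
  "I i ds = e (Fn i (map (inv e) ds))"

definition P :: "nat \<Rightarrow> 'u list \<Rightarrow> bool" where
  "P p ds \<longleftrightarrow> Pred p (map (inv e) ds) \<in> S"

definition v :: "var \<Rightarrow> 'u" where
  "v x = e (Var x)"

lemma is_interpretation: "is_interpretation (range e) I v"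
  by (auto simp: is_interpretation_def closed_on_def I_def v_def)

lemma eval_tm: "eval_tm I v t = e t"
proof (induction t)
  case (Fn i ts)
  then have "map (inv e) (map (eval_tm I v) ts) = ts"
    using e by (auto intro!: map_idI)
  then show ?case by (simp only: eval_tm.simps I_def[of i "map (eval_tm I v) ts"])
qed (simp add: v_def)

lemma irrefutable: "set As \<subseteq> S \<Longrightarrow> \<not> refut (fset_of_list As)"
  using S by (simp add: saturated_def fset_of_list.rep_eq)

lemma Neg_iff: "Neg A \<in> S \<longleftrightarrow> A \<notin> S"
  using S refut_NC[of A "{||}"] irrefutable[of "[A, Neg A]"] by (auto simp: saturated_def)

lemma Conj_iff: "Conj A B \<in> S \<longleftrightarrow> A \<in> S \<and> B \<in> S"
proof -
  have "refut {|Conj A B, Neg A|}"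
    by (rule refut_Conj, rule refut_mono[OF refut_NC[of A "{||}"]]) auto
  moreover have "refut {|Conj A B, Neg B|}"
    by (rule refut_Conj, rule refut_mono[OF refut_NC[of B "{||}"]]) auto
  moreover have "refut {|Neg (Conj A B), A, B|}"
    by (rule refut_Neg_Conj, rule refut_mono[OF refut_NC[of A "{||}"]], force,
      rule refut_mono[OF refut_NC[of B "{||}"]], force)
  ultimately show ?thesis
    using irrefutable[of "[Conj A B, Neg A]"] irrefutable[of "[Conj A B, Neg B]"]
      irrefutable[of "[Neg (Conj A B), A, B]"] by (auto simp: Neg_iff)
qed

lemma Disj_iff: "Disj A B \<in> S \<longleftrightarrow> A \<in> S \<or> B \<in> S"
proof -
  have "refut {|Neg (Disj A B), A|}"
    by (rule refut_Neg_Disj, rule refut_mono[OF refut_NC[of A "{||}"]]) auto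
  moreover have "refut {|Neg (Disj A B), B|}"
    by (rule refut_Neg_Disj, rule refut_mono[OF refut_NC[of B "{||}"]]) auto
  moreover have "refut {|Disj A B, Neg A, Neg B|}"
    by (rule refut_Disj, rule refut_mono[OF refut_NC[of A "{||}"]], force,
      rule refut_mono[OF refut_NC[of B "{||}"]], force)
  ultimately show ?thesis
    using irrefutable[of "[Neg (Disj A B), A]"] irrefutable[of "[Neg (Disj A B), B]"]
      irrefutable[of "[Disj A B, Neg A, Neg B]"] by (auto simp: Neg_iff)
qed

text \<open>Maximality puts the negation of a missing instance into \<open>S\<close>, and one use of
  the universal formula against it closes the component by \<open>NC\<close>. \<open>S\<close> is
  unchanged by this, so the formula serves for every instance.\<close>

lemma Forall_instance:
  assumes "Forall x A \<in> S" "rename_fm\<^sup>*\<^sup>* A A'" "free_for t x A'"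
  shows "subst_fm x t A' \<in> S"
proof (rule ccontr)
  assume "\<not> ?thesis"
  then have "\<not> refut {|Forall x A, Neg (subst_fm x t A')|}"
    using irrefutable[of "[Forall x A, Neg (subst_fm x t A')]"] assms by (simp add: Neg_iff)
  with refut_Forall[OF assms(2,3) refut_NC[of _ "{||}"]] show False by blast
qed

lemma Exists_instance:
  assumes "subst_fm x t A' \<in> S" "rename_fm\<^sup>*\<^sup>* A A'" "free_for t x A'"
  shows "Exists x A \<in> S"
proof (rule ccontr)
  assume "\<not> ?thesis"
  then have "\<not> refut {|Neg (Exists x A), subst_fm x t A'|}"
    using irrefutable[of "[Neg (Exists x A), subst_fm x t A']"] assms by (simp add: Neg_iff)
  moreover have "refut {|Neg (subst_fm x t A'), subst_fm x t A'|}"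
    by (rule refut_mono[OF refut_NC[of "subst_fm x t A'" "{||}"]]) auto
  ultimately show False using refut_Neg_Exists[OF assms(2,3)] by blast
qed

lemma holds_variant:
  assumes "rename_fm\<^sup>*\<^sup>* A A'" "free_for t x A'"
  shows "holds (range e) P I (v(x := e t)) A \<longleftrightarrow> holds (range e) P I v (subst_fm x t A')"
proof -
  have "holds (range e) P I (v(x := e t)) A' \<longleftrightarrow> holds (range e) P I (v(x := e t)) A"
    by (rule rename_fm_rtranclp_invariant[OF assms(1)]) (simp add: holds_rename_fm)
  then show ?thesis by (simp add: holds_subst_fm[OF assms(2)] eval_tm)
qed

text \<open>The induction is on \<open>rank\<close> because the quantifier cases pass to instances
  of variants of the body. Every element has the form \<open>e t\<close>, so quantifiers range over
  terms.\<close>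

lemma truth: "holds (range e) P I v A \<longleftrightarrow> A \<in> S"
proof (induction "rank A" arbitrary: A rule: less_induct)
  case less
  show ?case
  proof (cases A)
    case (Pred p ts)
    have "map (inv e) (map (eval_tm I v) ts) = ts"
      using e by (auto intro!: map_idI simp: eval_tm)
    then show ?thesis unfolding Pred by (simp only: holds.simps P_def)
  next
    case (Forall x B)
    have "holds (range e) P I (v(x := e t)) B" if "A \<in> S" for t
    proof -
      \<comment> \<open>The term \<open>t\<close> might be captured in \<open>B\<close>, so a
        variant whose bound variables avoid those of \<open>t\<close> is instantiated.\<close>
      obtain B' where B': "rename_fm\<^sup>*\<^sup>* B B'" "bv_fm B' \<inter> fv_tm t = {}"
        using ex_variant[of "fv_tm t" B] by auto
      then have ff: "free_for t x B'" by (intro free_for_bv) auto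
      have "rank B' = rank B" using B'(1) rename_fm_rank by (rule rename_fm_rtranclp_invariant)
      with less[of "subst_fm x t B'"] Forall_instance[OF _ B'(1) ff] that Forall
      show ?thesis by (simp add: holds_variant[OF B'(1) ff])
    qed
    moreover have "\<exists>t. \<not> holds (range e) P I (v(x := e t)) B" if "A \<notin> S"
    proof -
      from that Forall obtain g where "subst_fm x (Fn g []) B \<notin> S"
        using S unfolding saturated_def by (metis Neg_iff)
      with less[of "subst_fm x (Fn g []) B"] Forall holds_variant[of B B "Fn g []" x]
      show ?thesis by auto
    qed
    ultimately show ?thesis using Forall by auto
  next
    case (Exists x B)
    have "A \<in> S" if "holds (range e) P I (v(x := e t)) B" for t
    proof -
      obtain B' where B': "rename_fm\<^sup>*\<^sup>* B B'" "bv_fm B' \<inter> fv_tm t = {}"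
        using ex_variant[of "fv_tm t" B] by auto
      then have ff: "free_for t x B'" by (intro free_for_bv) auto
      have "rank B' = rank B" using B'(1) rename_fm_rank by (rule rename_fm_rtranclp_invariant)
      with less[of "subst_fm x t B'"] Exists_instance[OF _ B'(1) ff] that Exists
      show ?thesis by (simp add: holds_variant[OF B'(1) ff])
    qed
    moreover have "\<exists>t. holds (range e) P I (v(x := e t)) B" if "A \<in> S"
    proof -
      from that Exists obtain g where "subst_fm x (Fn g []) B \<in> S"
        using S unfolding saturated_def by metis
      with less[of "subst_fm x (Fn g []) B"] Exists holds_variant[of B B "Fn g []" x]
      show ?thesis by auto
    qed
    ultimately show ?thesis using Exists by auto
  qed (use less in \<open>auto simp: Neg_iff Conj_iff Disj_iff\<close>)
qed

end

lemma refut_if_unsatisfiable: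
  assumes inf: "infinite (UNIV :: 'u set)"
    and unsat: "\<not> satisfiable_expr TYPE('u) (Dat F {||} {|G|})"
  shows "refut G"
proof (rule ccontr)
  assume "\<not> refut G"
  then obtain S where S: "saturated S" and G: "fset G \<subseteq> S" using ex_saturated by blast
  obtain h :: "nat \<Rightarrow> 'u" where h: "inj h" using infinite_countable_subset[OF inf] by blast
  define e where "e = h \<circ> (to_nat :: tm \<Rightarrow> nat)"
  have "inj e" unfolding e_def using h inj_to_nat by (rule inj_compose)
  with S interpret term_model S e by (rule term_model.intro)
  have "verifies (range e) P I v (Dat F {||} {|G|})"
    unfolding verifies.simps
  \<comment> \<open>The term interpretation is its own witness for the existential prefix, whatever
    \<open>F\<close> is.\<close>
  proof (intro exI[of _ I] conjI allI impI)
    show "closed_on (range e) I" using is_interpretation unfolding is_interpretation_def by blast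
    fix w assume "range w \<subseteq> range e \<and> (\<forall>x. x |\<notin>| {||} \<longrightarrow> w x = v x)"
    then have "w = v" by auto
    then show "\<exists>G\<in>fset {|G|}. \<forall>A\<in>fset G. holds (range e) P I w A"
      using G truth by blast
  qed simp
  with is_interpretation unsat show False unfolding satisfiable_expr_def by blast
qed


section \<open>Collapsing the matrix to a single formula\<close>

text \<open>Synthetic \<open>Conj\<close> merges two formulas at a time. \<open>A\<close> is chosen
  before the context, so the induction can count the next formula as part of \<open>H\<close>. An
  empty component offers no formula to start from.\<close>

lemma collapse_component:
  assumes "G \<noteq> {||}"
  shows "\<exists>A. (\<forall>F X H R. inferable\<^sup>*\<^sup>* (Datum F X (finsert (G |\<union>| H) R)) (Datum F X (finsert (finsert A H) R))) \<and>
    (\<forall>xs. (\<forall>B\<in>fset G. ok_args {} xs B) \<longrightarrow> ok_args {} xs A) \<and>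
    funs_fm A = (\<Union>B\<in>fset G. funs_fm B) \<and>
    (\<forall>(D :: 'u set) P I v. holds D P I v A \<longleftrightarrow> (\<forall>B\<in>fset G. holds D P I v B))"
    (is "\<exists>A. ?P A G")
  using assms
proof (induction G)
  case (insert B G)
  show ?case
  proof (cases "G = {||}")
    case True
    then show ?thesis by (intro exI[of _ B]) auto
  next
    case False
    then obtain A where A: "?P A G" using insert.IH by (elim exE meta_impE)
    note ded = A[THEN conjunct1, rule_format]
    have "inferable\<^sup>*\<^sup>* (Datum F X (finsert (finsert B G |\<union>| H) R))
        (Datum F X (finsert (finsert (Conj A B) H) R))" for F X H R
    proof -
      have "inferable\<^sup>*\<^sup>* (Datum F X (finsert (G |\<union>| finsert B H) R))
          (Datum F X (finsert (finsert A (finsert B H)) R))"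
        by (rule ded)
      also have "inferable \<dots> (Datum F X (finsert (finsert (Conj A B) H) R))"
        by (intro inferable_synthetic analytic.Conj)
      finally show ?thesis by simp
    qed
    moreover have "ok_args {} xs (Conj A B)" if "\<forall>B\<in>fset (finsert B G). ok_args {} xs B" for xs
      using that A[THEN conjunct2, THEN conjunct1] by simp
    moreover have "funs_fm (Conj A B) = (\<Union>B\<in>fset (finsert B G). funs_fm B)"
      using A[THEN conjunct2, THEN conjunct2, THEN conjunct1] by auto
    moreover have "holds D P I v (Conj A B) \<longleftrightarrow> (\<forall>B\<in>fset (finsert B G). holds D P I v B)"
      for D :: "'u set" and P I v
      using A[THEN conjunct2, THEN conjunct2, THEN conjunct2] by auto
    ultimately show ?thesis by (intro exI[of _ "Conj A B"] conjI allI impI)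
  qed
qed simp

text \<open>The same scheme one level up, with synthetic \<open>Disj\<close>: components not yet
  collapsed wait in \<open>R\<close>.\<close>

lemma collapse_matrix:
  assumes "M \<noteq> {||}" "{||} |\<notin>| M"
  shows "\<exists>A. (\<forall>F X R. inferable\<^sup>*\<^sup>* (Datum F X (M |\<union>| R)) (Datum F X (finsert {|A|} R))) \<and>
    (\<forall>xs. (\<forall>G\<in>fset M. \<forall>B\<in>fset G. ok_args {} xs B) \<longrightarrow> ok_args {} xs A) \<and>
    funs_fm A = funs_mat M \<and>
    (\<forall>(D :: 'u set) P I v. holds D P I v A \<longleftrightarrow> (\<exists>G\<in>fset M. \<forall>B\<in>fset G. holds D P I v B))"
    (is "\<exists>A. ?P A M")
  using assms
proof (induction M)
  case (insert G M)
  then have "G \<noteq> {||}" by auto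
  from collapse_component[OF this, where 'u = 'u] obtain B where B:
    "(\<forall>F X H R. inferable\<^sup>*\<^sup>* (Datum F X (finsert (G |\<union>| H) R)) (Datum F X (finsert (finsert B H) R))) \<and>
    (\<forall>xs. (\<forall>B\<in>fset G. ok_args {} xs B) \<longrightarrow> ok_args {} xs B) \<and>
    funs_fm B = (\<Union>B\<in>fset G. funs_fm B) \<and>
    (\<forall>(D :: 'u set) P I v. holds D P I v B \<longleftrightarrow> (\<forall>B\<in>fset G. holds D P I v B))"
    by (rule exE)
  note dedB = B[THEN conjunct1, rule_format]
    and okB = B[THEN conjunct2, THEN conjunct1, rule_format]
    and funsB = B[THEN conjunct2, THEN conjunct2, THEN conjunct1]
    and holdsB = B[THEN conjunct2, THEN conjunct2, THEN conjunct2, rule_format]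
  show ?case
  proof (cases "M = {||}")
    case True
    have "inferable\<^sup>*\<^sup>* (Datum F X (finsert G M |\<union>| R)) (Datum F X (finsert {|B|} R))" for F X R
      using dedB[where H = "{||}"] True by simp
    moreover have "ok_args {} xs B" if "\<forall>G\<in>fset (finsert G M). \<forall>B\<in>fset G. ok_args {} xs B" for xs
      using that by (intro okB) simp
    moreover have "funs_fm B = funs_mat (finsert G M)" using funsB True by (simp add: funs_mat_def)
    moreover have "holds D P I v B \<longleftrightarrow> (\<exists>G\<in>fset (finsert G M). \<forall>B\<in>fset G. holds D P I v B)"
      for D :: "'u set" and P I v
      using holdsB True by simp
    ultimately show ?thesis by (intro exI[of _ B] conjI allI impI)
  next
    case False
    have "{||} |\<notin>| M" using insert.prems by simp
    with False obtain A where A: "?P A M" using insert.IH by (elim exE meta_impE)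
    note ded = A[THEN conjunct1, rule_format]
      and okA = A[THEN conjunct2, THEN conjunct1, rule_format]
      and funsA = A[THEN conjunct2, THEN conjunct2, THEN conjunct1]
      and holdsA = A[THEN conjunct2, THEN conjunct2, THEN conjunct2, rule_format]
    have "inferable\<^sup>*\<^sup>* (Datum F X (finsert G M |\<union>| R)) (Datum F X (finsert {|Disj A B|} R))" for F X R
    proof -
      have "inferable\<^sup>*\<^sup>* (Datum F X (M |\<union>| finsert G R)) (Datum F X (finsert {|A|} (finsert G R)))"
        by (rule ded)
      also have "\<dots> = Datum F X (finsert (G |\<union>| {||}) (finsert {|A|} R))"
        by (simp add: finsert_commute)
      also have "inferable\<^sup>*\<^sup>* \<dots> (Datum F X (finsert {|B|} (finsert {|A|} R)))"
        by (rule dedB)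
      also have "\<dots> = Datum F X (finsert {|A|} (finsert {|B|} R))"
        by (simp add: finsert_commute)
      also have "inferable \<dots> (Datum F X (finsert {|Disj A B|} R))"
        by (intro inferable_synthetic analytic.Disj)
      finally show ?thesis by simp
    qed
    moreover have "ok_args {} xs (Disj A B)"
      if "\<forall>G\<in>fset (finsert G M). \<forall>B\<in>fset G. ok_args {} xs B" for xs
      using that okA[of xs] okB[of xs] by simp
    moreover have "funs_fm (Disj A B) = funs_mat (finsert G M)"
      using funsA funsB by (auto simp: funs_mat_def)
    moreover have "holds D P I v (Disj A B) \<longleftrightarrow> (\<exists>G\<in>fset (finsert G M). \<forall>B\<in>fset G. holds D P I v B)"
      for D :: "'u set" and P I v
      using holdsA holdsB by auto
    ultimately show ?thesis by (intro exI[of _ "Disj A B"] conjI allI impI)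
  qed
qed simp


section \<open>Eliminating the prefix\<close>

text \<open>What remains of standardness when bound variables have been renamed away from
  \<open>xs\<close>: scopes are no longer tracked, and argument lists are still initial segments of
  the current universal prefix.\<close>

primrec args_tm :: "var list \<Rightarrow> tm \<Rightarrow> bool" where
  "args_tm xs (Var x) \<longleftrightarrow> True"
| "args_tm xs (Fn i ts) \<longleftrightarrow> (\<exists>k \<le> length xs. ts = map Var (take k xs))"

primrec args_fm :: "var list \<Rightarrow> fm \<Rightarrow> bool" where
  "args_fm xs (Pred p ts) \<longleftrightarrow> (\<forall>t\<in>set ts. args_tm xs t)"
| "args_fm xs (Neg A) \<longleftrightarrow> args_fm xs A"
| "args_fm xs (Conj A B) \<longleftrightarrow> args_fm xs A \<and> args_fm xs B"
| "args_fm xs (Disj A B) \<longleftrightarrow> args_fm xs A \<and> args_fm xs B"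
| "args_fm xs (Forall x A) \<longleftrightarrow> args_fm xs A"
| "args_fm xs (Exists x A) \<longleftrightarrow> args_fm xs A"

text \<open>Arguments are not traversed: under \<open>args_tm\<close> they are variables.\<close>

primrec abs_tm :: "nat \<Rightarrow> nat \<Rightarrow> var \<Rightarrow> tm \<Rightarrow> tm" where
  "abs_tm g n y (Var x) = Var x"
| "abs_tm g n y (Fn i ts) = (if i = g \<and> length ts = n then Var y else Fn i ts)"

primrec abs_fm :: "nat \<Rightarrow> nat \<Rightarrow> var \<Rightarrow> fm \<Rightarrow> fm" where
  "abs_fm g n y (Pred p ts) = Pred p (map (abs_tm g n y) ts)"
| "abs_fm g n y (Neg A) = Neg (abs_fm g n y A)"
| "abs_fm g n y (Conj A B) = Conj (abs_fm g n y A) (abs_fm g n y B)"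
| "abs_fm g n y (Disj A B) = Disj (abs_fm g n y A) (abs_fm g n y B)"
| "abs_fm g n y (Forall x A) = Forall x (abs_fm g n y A)"
| "abs_fm g n y (Exists x A) = Exists x (abs_fm g n y A)"

lemma args_fm_if_ok_args: "ok_args C xs A \<Longrightarrow> args_fm xs A"
proof (induction A arbitrary: C)
  case (Pred p ts)
  have "args_tm xs t" if "t \<in> set ts" for t
  proof (cases t)
    case (Fn i us)
    then have "({}, Fn i us) \<in> fterms_fm (Pred p ts)" using that by (auto intro!: bexI[of _ t])
    then obtain k where "k \<le> length xs" "us = map Var (take k xs)"
      using Pred unfolding ok_args_def by blast
    then show ?thesis using Fn by auto
  qed simp
  then show ?case by simp
qed auto

text \<open>The last variable belongs only to the initial segment of full length, so it disappears
  from the arguments together with the functions of full arity.\<close>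

lemma args_tm_butlast:
  assumes "args_tm (xs @ [x]) t" "\<And>g. (g, Suc (length xs)) \<notin> funs_tm t"
  shows "args_tm xs t"
proof (cases t)
  case (Fn i ts)
  with assms(1) obtain k where k: "k \<le> Suc (length xs)" "ts = map Var (take k (xs @ [x]))" by auto
  moreover have "k \<noteq> Suc (length xs)" using assms(2)[of i] Fn k by auto
  ultimately have "k \<le> length xs" "ts = map Var (take k xs)" by auto
  then show ?thesis using Fn by auto
qed simp

lemma args_fm_butlast:
  "args_fm (xs @ [x]) A \<Longrightarrow> (\<And>g. (g, Suc (length xs)) \<notin> funs_fm A) \<Longrightarrow> args_fm xs A"
proof (induction A)
  case (Pred p ts)
  then have "args_tm xs t" if "t \<in> set ts" for t
    using that by (intro args_tm_butlast[of xs x t]) auto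
  then show ?case by simp
qed auto

text \<open>A term headed by \<open>g\<close> with \<open>length xs\<close> arguments can only be
  \<open>g\<close> applied to all of \<open>xs\<close>, so one variable \<open>y\<close> can stand
  for all its occurrences.\<close>

lemma subst_abs_tm:
  assumes "args_tm xs t" "y \<notin> fv_tm t"
  shows "subst_tm y (Fn g (map Var xs)) (abs_tm g (length xs) y t) = t"
proof (cases "\<exists>ts. t = Fn g ts \<and> length ts = length xs")
  case True
  with assms(1) have "t = Fn g (map Var xs)" by auto
  then show ?thesis by simp
next
  case False
  then have "abs_tm g (length xs) y t = t" by (cases t) auto
  then show ?thesis using assms(2) by (simp add: subst_tm_fresh)
qed

lemma subst_abs_fm:
  "args_fm xs A \<Longrightarrow> y \<notin> fv_fm A \<Longrightarrow> y \<notin> bv_fm A \<Longrightarrow>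
    subst_fm y (Fn g (map Var xs)) (abs_fm g (length xs) y A) = A"
  by (induction A) (auto intro!: map_idI subst_abs_tm simp del: subst_tm.simps(2))

lemma bv_abs_fm [simp]: "bv_fm (abs_fm g n y A) = bv_fm A"
  by (induction A) auto

lemma funs_abs_tm: "args_tm xs t \<Longrightarrow> funs_tm (abs_tm g n y t) = funs_tm t - {(g, n)}"
  by (cases t) auto

lemma funs_abs_fm: "args_fm xs A \<Longrightarrow> funs_fm (abs_fm g n y A) = funs_fm A - {(g, n)}"
  by (induction A) (auto simp: funs_abs_tm[of xs])

lemma args_abs_fm: "args_fm xs A \<Longrightarrow> args_fm xs (abs_fm g n y A)"
proof (induction A)
  case (Pred p ts)
  have "args_tm xs (abs_tm g n y t)" if "args_tm xs t" for t
    using that by (cases t) auto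
  with Pred show ?case by auto
qed auto

section \<open>Satisfiability along the synthetic quantifier steps\<close>

lemma eval_tm_funs_cong:
  "(\<And>i ds. (i, length ds) \<in> funs_tm t \<Longrightarrow> I i ds = J i ds) \<Longrightarrow> eval_tm I v t = eval_tm J v t"
proof (induction t)
  case (Fn i ts)
  then have "map (eval_tm I v) ts = map (eval_tm J v) ts" by auto
  moreover have "I i ds = J i ds" if "length ds = length ts" for ds
    using Fn.prems[of i ds] that by simp
  ultimately show ?case unfolding eval_tm.simps by (metis length_map)
qed simp

lemma holds_funs_cong:
  "(\<And>i ds. (i, length ds) \<in> funs_fm A \<Longrightarrow> I i ds = J i ds) \<Longrightarrow> holds D P I v A \<longleftrightarrow> holds D P J v A"
proof (induction A arbitrary: v)
  case (Pred p ts)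
  then have "map (eval_tm I v) ts = map (eval_tm J v) ts"
    by (auto intro!: eval_tm_funs_cong)
  then show ?case by (simp only: holds.simps)
qed auto

lemma satisfiable_expr_single_iff:
  "satisfiable_expr (U :: 'u itself) (Dat F X {|{|A|}|}) \<longleftrightarrow>
    (\<exists>(D :: 'u set) P I v J. is_interpretation D I v \<and> closed_on D J \<and>
      (\<forall>i ds. (i, length ds) |\<notin>| F \<longrightarrow> J i ds = I i ds) \<and>
      (\<forall>w. range w \<subseteq> D \<longrightarrow> (\<forall>x. x |\<notin>| X \<longrightarrow> w x = v x) \<longrightarrow> holds D P J w A))"
  by (simp add: satisfiable_expr_def imp_conjL)

lemma satisfiable_Forall:
  assumes "satisfiable_expr U (Dat F X {|{|Forall x A|}|})"
  shows "satisfiable_expr U (Dat F (finsert x X) {|{|A|}|})"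
proof -
  from assms obtain D :: "'a set" and P I v J where int: "is_interpretation D I v"
    and J: "closed_on D J" "\<forall>i ds. (i, length ds) |\<notin>| F \<longrightarrow> J i ds = I i ds"
    and h: "\<And>w. range w \<subseteq> D \<Longrightarrow> \<forall>x. x |\<notin>| X \<longrightarrow> w x = v x \<Longrightarrow> holds D P J w (Forall x A)"
    unfolding satisfiable_expr_single_iff by blast
  have "holds D P J w A" if w: "range w \<subseteq> D" "\<forall>z. z |\<notin>| finsert x X \<longrightarrow> w z = v z" for w
  proof -
    have "range v \<subseteq> D" using int by (simp add: is_interpretation_def)
    then have "holds D P J (w(x := v x)) (Forall x A)"
      using w by (intro h) auto
    moreover have "w x \<in> D" using w by auto
    ultimately show ?thesis by (metis fun_upd_triv fun_upd_upd holds.simps(5))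
  qed
  with int J show ?thesis unfolding satisfiable_expr_single_iff by blast
qed

text \<open>Skolemization: a witness is chosen as a function of the values of the universal
  variables. As \<open>g\<close> is in \<open>F\<close> and does not occur in \<open>A\<close>, it
  can be reinterpreted by this function without disturbing \<open>A\<close>.\<close>

lemma satisfiable_Exists:
  assumes sat: "satisfiable_expr U (Dat F X {|{|Exists y A|}|})"
    and xs: "distinct xs" "set xs = fset X" and g: "(g, length xs) |\<in>| F" "(g, length xs) \<notin> funs_fm A"
    and ff: "free_for (Fn g (map Var xs)) y A"
  shows "satisfiable_expr U (Dat F X {|{|subst_fm y (Fn g (map Var xs)) A|}|})"
proof -
  from sat obtain D :: "'a set" and P I v J where int: "is_interpretation D I v"
    and J: "closed_on D J" "\<And>i ds. (i, length ds) |\<notin>| F \<Longrightarrow> J i ds = I i ds"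
    and h: "\<And>w. range w \<subseteq> D \<Longrightarrow> \<forall>x. x |\<notin>| X \<longrightarrow> w x = v x \<Longrightarrow> holds D P J w (Exists y A)"
    unfolding satisfiable_expr_single_iff by blast
  \<comment> \<open>\<open>upd ds\<close> recovers a valuation from the values \<open>ds\<close> of
    the prefix variables, with \<open>v\<close> as default elsewhere.\<close>
  define upd where "upd ds x = (case map_of (zip xs ds) x of None \<Rightarrow> v x | Some d \<Rightarrow> d)" for ds x
  define wit where "wit ds = (SOME d. d \<in> D \<and> holds D P J ((upd ds)(y := d)) A)" for ds
  \<comment> \<open>The choice \<open>wit\<close> is justified only for lists over \<open>D\<close>
    of the right length; elsewhere \<open>J\<close> is kept.\<close>
  define K where "K i ds = (if i = g \<and> length ds = length xs \<and> set ds \<subseteq> D then wit ds else J i ds)" for i ds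
  have upd: "upd (map w xs) = w" if "\<forall>x. x |\<notin>| X \<longrightarrow> w x = v x" for w
  proof
    fix x
    show "upd (map w xs) x = w x"
      using that xs by (cases "x \<in> set xs") (auto simp: upd_def map_of_zip_map)
  qed
  have wit: "wit ds \<in> D \<and> holds D P J ((upd ds)(y := wit ds)) A"
    if ds: "length ds = length xs" "set ds \<subseteq> D" for ds
  proof -
    have v: "v x \<in> D" for x using int by (auto simp: is_interpretation_def)
    have "range (upd ds) \<subseteq> D"
      using v by (auto simp: upd_def split: option.splits
          dest!: map_of_SomeD set_zip_rightD intro: subsetD[OF ds(2)])
    moreover have "\<forall>x. x |\<notin>| X \<longrightarrow> upd ds x = v x"
      using xs(2) ds(1) by (auto simp: upd_def split: option.splits dest!: map_of_SomeD set_zip_leftD)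
    ultimately have "holds D P J (upd ds) (Exists y A)" by (rule h)
    then have "\<exists>d. d \<in> D \<and> holds D P J ((upd ds)(y := d)) A" by (simp add: Bex_def)
    then show ?thesis unfolding wit_def by (rule someI_ex)
  qed
  have "closed_on D K" using J(1) wit by (auto simp: closed_on_def K_def)
  moreover have "\<forall>i ds. (i, length ds) |\<notin>| F \<longrightarrow> K i ds = I i ds"
    using J(2) g(1) by (auto simp: K_def)
  moreover have "holds D P K w (subst_fm y (Fn g (map Var xs)) A)"
    if w: "range w \<subseteq> D" "\<forall>x. x |\<notin>| X \<longrightarrow> w x = v x" for w
  proof -
    have D: "set (map w xs) \<subseteq> D" using w by auto
    have "eval_tm K w (Fn g (map Var xs)) = K g (map w xs)"
      by (simp add: comp_def)
    also have "\<dots> = wit (map w xs)" using D by (simp add: K_def)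
    finally have e: "eval_tm K w (Fn g (map Var xs)) = wit (map w xs)" .
    have "holds D P J (w(y := wit (map w xs))) A"
      using wit[OF _ D] upd[OF w(2)] by simp
    moreover have "K i ds = J i ds" if "(i, length ds) \<in> funs_fm A" for i ds
      using that g(2) by (auto simp: K_def)
    ultimately have "holds D P K (w(y := wit (map w xs))) A"
      using holds_funs_cong[of A K J] by blast
    then show ?thesis by (simp only: holds_subst_fm[OF ff] e)
  qed
  ultimately show ?thesis using int unfolding satisfiable_expr_single_iff by blast
qed

text \<open>Each round abstracts one functional variable of full arity, so the number of functional
  variables in the formula drops.\<close>

lemma eliminate_functions:
  assumes "distinct xs" "args_fm xs A" "bv_fm A \<inter> set xs = {}" "funs_fm A \<subseteq> fset F"
  shows "\<exists>B. inferable\<^sup>*\<^sup>* (Datum F (fset_of_list xs) {|{|A|}|}) (Datum F (fset_of_list xs) {|{|B|}|}) \<and>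
    args_fm xs B \<and> bv_fm B \<inter> set xs = {} \<and> funs_fm B \<subseteq> funs_fm A \<and> (\<forall>g. (g, length xs) \<notin> funs_fm B) \<and>
    (satisfiable_expr U (Dat F (fset_of_list xs) {|{|B|}|}) \<longrightarrow>
      satisfiable_expr U (Dat F (fset_of_list xs) {|{|A|}|}))"
  using assms(2-4)
proof (induction "card (funs_fm A)" arbitrary: A rule: less_induct)
  case less
  show ?case
  proof (cases "\<exists>g. (g, length xs) \<in> funs_fm A")
    case False
    with less.prems show ?thesis by (intro exI[of _ A]) auto
  next
    case True
    then obtain g where g: "(g, length xs) \<in> funs_fm A" by blast
    let ?V = "fv_fm A \<union> bv_fm A \<union> set xs"
    obtain y where y: "y \<notin> ?V" by (rule obtain_fresh_var[of ?V]) auto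
    define B where "B = abs_fm g (length xs) y A"
    let ?t = "Fn g (map Var xs)"
    have funs: "funs_fm B = funs_fm A - {(g, length xs)}"
      unfolding B_def using less.prems(1) by (rule funs_abs_fm)
    have ff: "free_for ?t y B" using less.prems(2) by (intro free_for_bv) (auto simp: B_def)
    have sub: "subst_fm y ?t B = A"
      unfolding B_def using y less.prems(1) by (intro subst_abs_fm) auto
    \<comment> \<open>The prefix already contains the abstracted function and, being a set, is left
      unchanged by the synthetic rule.\<close>
    have F: "finsert (g, length xs) F = F" using g less.prems(3) by auto
    have "analytic (Dat F (fset_of_list xs) {|{|Exists y B|}|})
        (Dat (finsert (g, length xs) F) (fset_of_list xs) {|{|subst_fm y ?t B|}|})"
      using assms(1) ff funs
      by (intro analytic.Exists) (auto simp: fset_of_list.rep_eq funs_mat_def)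
    then have ded: "inferable (Datum F (fset_of_list xs) {|{|A|}|})
        (Datum F (fset_of_list xs) {|{|Exists y B|}|})"
      unfolding F sub by (rule inferable_synthetic)
    have "satisfiable_expr U (Dat F (fset_of_list xs) {|{|subst_fm y ?t B|}|})"
      if "satisfiable_expr U (Dat F (fset_of_list xs) {|{|Exists y B|}|})"
      using that assms(1) _ _ _ ff by (rule satisfiable_Exists) (use g less.prems(3) funs in \<open>auto simp: fset_of_list.rep_eq\<close>)
    then have sat: "satisfiable_expr U (Dat F (fset_of_list xs) {|{|A|}|})"
      if "satisfiable_expr U (Dat F (fset_of_list xs) {|{|Exists y B|}|})"
      using that sub by simp
    have "card (funs_fm (Exists y B)) < card (funs_fm A)"
      unfolding fv_fm.simps funs_fm.simps funs using g by (intro psubset_card_mono) auto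
    moreover have "args_fm xs (Exists y B)" using less.prems(1) by (simp add: B_def args_abs_fm)
    moreover have "bv_fm (Exists y B) \<inter> set xs = {}" using less.prems(2) y by (auto simp: B_def)
    moreover have "funs_fm (Exists y B) \<subseteq> fset F" using less.prems(3) funs by auto
    ultimately obtain C where C: "inferable\<^sup>*\<^sup>* (Datum F (fset_of_list xs) {|{|Exists y B|}|})
        (Datum F (fset_of_list xs) {|{|C|}|})"
      "args_fm xs C" "bv_fm C \<inter> set xs = {}" "funs_fm C \<subseteq> funs_fm (Exists y B)"
      "\<forall>g. (g, length xs) \<notin> funs_fm C"
      "satisfiable_expr U (Dat F (fset_of_list xs) {|{|C|}|}) \<longrightarrow>
        satisfiable_expr U (Dat F (fset_of_list xs) {|{|Exists y B|}|})"
      using less.hyps[of "Exists y B"] by blast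
    have "inferable\<^sup>*\<^sup>* (Datum F (fset_of_list xs) {|{|A|}|}) (Datum F (fset_of_list xs) {|{|C|}|})"
      using ded C(1) by (rule converse_rtranclp_into_rtranclp)
    with C sat funs show ?thesis by (intro exI[of _ C]) auto
  qed
qed

text \<open>Variables are quantified from the last to the first. After
  \<open>eliminate_functions\<close> no functional term has the last variable as an argument, so
  \<open>args_fm\<close> holds for the shorter prefix.\<close>

lemma eliminate_universal:
  assumes "distinct xs" "args_fm xs A" "bv_fm A \<inter> set xs = {}" "funs_fm A \<subseteq> fset F"
  shows "\<exists>B. inferable\<^sup>*\<^sup>* (Datum F (fset_of_list xs) {|{|A|}|}) (Datum F {||} {|{|B|}|}) \<and>
    (satisfiable_expr U (Dat F {||} {|{|B|}|}) \<longrightarrow>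
      satisfiable_expr U (Dat F (fset_of_list xs) {|{|A|}|}))"
  using assms
proof (induction xs arbitrary: A rule: rev_induct)
  \<comment> \<open>Nullary functional variables may survive in \<open>A\<close>; they are left in
    the prefix as constants.\<close>
  case Nil
  then show ?case by (intro exI[of _ A]) auto
next
  case (snoc x xs)
  let ?xs = "xs @ [x]"
  obtain B where B: "inferable\<^sup>*\<^sup>* (Datum F (fset_of_list ?xs) {|{|A|}|}) (Datum F (fset_of_list ?xs) {|{|B|}|})"
    "args_fm ?xs B" "bv_fm B \<inter> set ?xs = {}" "funs_fm B \<subseteq> funs_fm A"
    "\<And>g. (g, length ?xs) \<notin> funs_fm B"
    "satisfiable_expr U (Dat F (fset_of_list ?xs) {|{|B|}|}) \<Longrightarrow>
      satisfiable_expr U (Dat F (fset_of_list ?xs) {|{|A|}|})"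
    using eliminate_functions[OF snoc.prems, of U] by blast
  have X: "fset_of_list ?xs = finsert x (fset_of_list xs)"
    by (simp add: fset_of_list_append)
  have "args_fm xs (Forall x B)" using args_fm_butlast[OF B(2)] B(5) by simp
  moreover have "bv_fm (Forall x B) \<inter> set xs = {}" using B(3) snoc.prems(1) by auto
  ultimately obtain C where C: "inferable\<^sup>*\<^sup>* (Datum F (fset_of_list xs) {|{|Forall x B|}|}) (Datum F {||} {|{|C|}|})"
    "satisfiable_expr U (Dat F {||} {|{|C|}|}) \<Longrightarrow>
      satisfiable_expr U (Dat F (fset_of_list xs) {|{|Forall x B|}|})"
    using snoc.IH[of "Forall x B"] snoc.prems B(4) by auto
  note B(1)
  \<comment> \<open>The matrix consists of a single formula, so the proviso of the
    \<open>Forall\<close> rule is vacuous.\<close>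
  also have "inferable (Datum F (fset_of_list ?xs) {|{|B|}|}) (Datum F (fset_of_list xs) {|{|Forall x B|}|})"
    unfolding X by (intro inferable_synthetic analytic.Forall) (auto simp: fv_set_def fv_mat_def)
  also note C(1)
  finally show ?case using C(2) B(6) satisfiable_Forall[of U F "fset_of_list xs" x B] unfolding X by blast
qed


section \<open>Completeness\<close>

lemma standard_unsatisfiable_refutable:
  assumes inf: "infinite (UNIV :: 'u set)"
    and std: "standard_expr (Dat F X M)"
    and unsat: "\<not> satisfiable_expr TYPE('u) (Dat F X M)"
  shows "QDC_refutable (Datum F X M)"
proof (cases "M = {||}")
  case True
  then show ?thesis by (simp add: QDC_refutable_iff deduce_bottom)
next
  case False
  \<comment> \<open>An empty component is true under every interpretation and would make the datum
    satisfiable.\<close>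
  have "{||} |\<notin>| M"
  proof
    assume "{||} |\<in>| M"
    then have "verifies UNIV P I v (Dat F X M)" for P and I :: "nat \<Rightarrow> 'u list \<Rightarrow> 'u" and v
      unfolding verifies.simps by (intro exI[of _ I]) (auto simp: closed_on_def intro!: bexI[of _ "{||}"])
    moreover have "is_interpretation UNIV (I :: nat \<Rightarrow> 'u list \<Rightarrow> 'u) v" for I v
      by (simp add: is_interpretation_def closed_on_def)
    ultimately have "satisfiable_expr TYPE('u) (Dat F X M)"
      unfolding satisfiable_expr_def by blast
    with unsat show False by blast
  qed
  from collapse_matrix[OF False this, where 'u = 'u] obtain A where A:
    "(\<forall>F X R. inferable\<^sup>*\<^sup>* (Datum F X (M |\<union>| R)) (Datum F X (finsert {|A|} R))) \<and>
    (\<forall>xs. (\<forall>G\<in>fset M. \<forall>B\<in>fset G. ok_args {} xs B) \<longrightarrow> ok_args {} xs A) \<and>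
    funs_fm A = funs_mat M \<and>
    (\<forall>(D :: 'u set) P I v. holds D P I v A \<longleftrightarrow> (\<exists>G\<in>fset M. \<forall>B\<in>fset G. holds D P I v B))"
    by (rule exE)
  note ded = A[THEN conjunct1, rule_format]
    and ok = A[THEN conjunct2, THEN conjunct1, THEN spec, THEN mp]
    and funs = A[THEN conjunct2, THEN conjunct2, THEN conjunct1]
    and h = A[THEN conjunct2, THEN conjunct2, THEN conjunct2, rule_format]
  from std ok obtain xs where xs: "distinct xs" "set xs = fset X" "ok_args {} xs A"
    and F: "funs_fm A \<subseteq> fset F"
    unfolding standard_expr_iff funs by blast
  have X: "X = fset_of_list xs" using xs(2) by (simp add: fset_eq_iff fset_of_list.rep_eq)
  \<comment> \<open>Bound variables leave the universal prefix before scopes are forgotten: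
    \<open>ok_args\<close> survives renaming and then yields \<open>args_fm\<close>.\<close>
  obtain B where B: "rename_fm\<^sup>*\<^sup>* A B" "bv_fm B \<inter> set xs = {}"
    using ex_variant[of "set xs" A] by auto
  have "ok_args {} xs B"
    using B(1) xs(3) by (induction rule: rtranclp_induct) (auto intro: rename_fm_ok_args)
  then have args: "args_fm xs B" by (rule args_fm_if_ok_args)
  have funsB: "funs_fm B \<subseteq> fset F"
    using rename_fm_rtranclp_invariant[OF B(1), of funs_fm] rename_fm_funs F by auto
  have holdsB: "holds D P I v B \<longleftrightarrow> holds D P I v A" for D :: "'u set" and P I v
    by (rule rename_fm_rtranclp_invariant[OF B(1)]) (simp add: holds_rename_fm)
  have "\<not> satisfiable_expr TYPE('u) (Dat F (fset_of_list xs) {|{|B|}|})"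
    using unsat unfolding X satisfiable_expr_def verifies.simps by (simp add: holdsB h)
  with eliminate_universal[OF xs(1) args B(2) funsB, of "TYPE('u)"] obtain C where
    C: "inferable\<^sup>*\<^sup>* (Datum F X {|{|B|}|}) (Datum F {||} {|{|C|}|})"
    "\<not> satisfiable_expr TYPE('u) (Dat F {||} {|{|C|}|})"
    unfolding X by blast
  have "refut {|C|}" using inf C(2) by (rule refut_if_unsatisfiable)
  have "inferable\<^sup>*\<^sup>* (Datum F X M) (Datum F X {|{|A|}|})" using ded[of F X "{||}"] by simp
  also have "Datum F X {|{|A|}|} = Datum F X {|{|B|}|}" using B(1) by (rule Datum_rename_fm)
  also note C(1)
  also have "inferable\<^sup>*\<^sup>* (Datum F {||} {|{|C|}|}) (Datum F {||} {||})"
    using \<open>refut {|C|}\<close> by (rule refutD)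
  also have "inferable\<^sup>*\<^sup>* (Datum F {||} {||}) bottom" by (rule deduce_bottom)
  finally show ?thesis by (simp add: QDC_refutable_iff)
qed

theorem mainTheorem3:
  fixes d :: datum
  assumes "infinite (UNIV :: 'u set)"
    and "standard d"
    and "\<not> satisfiable TYPE('u) d"
  shows "QDC_refutable d"
proof -
  have "\<exists>F X M. d = Datum F X M"
  proof (induction d rule: datum.abs_induct)
    case (1 e)
    then show ?case by (cases e) (auto simp: Datum.abs_eq)
  qed
  then obtain F X M where d: "d = Datum F X M" by blast
  show ?thesis
    using assms standard_unsatisfiable_refutable[of F X M, where 'u = 'u]
    by (simp add: d Datum.abs_eq standard.abs_eq satisfiable.abs_eq)
qed

end
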